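(* For every graph $G$, $$\mathrm{mis}(G)\;\leq\;\max_{H\in\mathcal{H}(G)}\mathrm{mis}(H)\;\leq\;\max_{H\in\mathcal{H}'(G)}\mathrm{mis}(H)\;\leq\;\left(\frac{3}{2}\right)^{m(G)}\mathrm{mis}(G).$$
   Context: Graphs are finite, simple and undirected. $C_4$ is the cycle of length 4. $\mathrm{mis}(G)$ is the number of (inclusion-)maximal independent sets of $G$. $m(G)$ is the maximum size of a matching $M$ of $G$ such that every edge of $M$ is contained in an induced copy of $C_4$ (in $G$) that contains no other edge of $M$. $\mathcal{H}(G)$ is the set of graphs obtained from $G$ by contracting some edges (loops and multiple edges are discarded; $G\in\mathcal{H}(G)$ by convention). For a connected subgraph $C$ of $G$ with at least two vertices, $G/C$ is the graph obtained from $G$ by contracting $C$ into a single new vertex $c$ (so $c$ is adjacent to every vertex outside $C$ that has a neighbor in $C$; loops and multiple edges are discarded) and by adding a new vertex $c'$ together with the edge $cc'$. $\mathcal{H}'(G)$ is the set of graphs that can be obtained from $G$ by repeating such an operation (any number of times, including zero, so $G\in\mathcal{H}'(G)$). *)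

theory Defs
  imports Complex_Main "Graph_Theory.Graph_Theory"
begin

text \<open>
  A finite simple undirected graph is a \<open>pair_graph\<close>: finite, loop-free, and every edge
  is present as both arcs \<open>(u, v)\<close> and \<open>(v, u)\<close>. Undirected edges, as needed for matchings,
  are the two-element sets below.
\<close>

definition uedges :: "'a pair_pre_digraph \<Rightarrow> 'a set set" where
  "uedges G = {{u, v} |u v. (u, v) \<in> parcs G}"

definition independent_set :: "'a pair_pre_digraph \<Rightarrow> 'a set \<Rightarrow> bool" where
  "independent_set G I \<longleftrightarrow> I \<subseteq> pverts G \<and> (\<forall>u\<in>I. \<forall>v\<in>I. (u, v) \<notin> parcs G)"

definition maximal_independent_set :: "'a pair_pre_digraph \<Rightarrow> 'a set \<Rightarrow> bool" where
  "maximal_independent_set G I \<longleftrightarrow>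
     independent_set G I \<and> (\<forall>J. independent_set G J \<and> I \<subseteq> J \<longrightarrow> J = I)"

definition mis :: "'a pair_pre_digraph \<Rightarrow> nat" where
  "mis G = card {I. maximal_independent_set G I}"

definition matching :: "'a pair_pre_digraph \<Rightarrow> 'a set set \<Rightarrow> bool" where
  "matching G M \<longleftrightarrow> M \<subseteq> uedges G \<and> (\<forall>e\<in>M. \<forall>f\<in>M. e \<noteq> f \<longrightarrow> e \<inter> f = {})"

definition is_C4 :: "'a pair_pre_digraph \<Rightarrow> bool" where
  "is_C4 Q \<longleftrightarrow> (\<exists>a b c d. distinct [a, b, c, d] \<and> pverts Q = {a, b, c, d} \<and>
     uedges Q = {{a, b}, {b, c}, {c, d}, {d, a}})"

definition C4_private_matching :: "'a pair_pre_digraph \<Rightarrow> 'a set set \<Rightarrow> bool" where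
  "C4_private_matching G M \<longleftrightarrow> matching G M \<and>
     (\<forall>e\<in>M. \<exists>Q. induced_subgraph (with_proj Q) (with_proj G) \<and> is_C4 Q \<and> uedges Q \<inter> M = {e})"

definition C4_matching_number :: "'a pair_pre_digraph \<Rightarrow> nat" where
  "C4_matching_number G = Max (card ` {M. C4_private_matching G M})"

text \<open>
  Contraction of the vertex set \<open>S\<close> into the vertex \<open>c\<close>; the side condition \<open>f u \<noteq> f v\<close>
  discards loops, and taking a set of pairs discards multiple edges. It is only used with
  \<open>c\<close> outside the remaining vertices \<open>pverts G - S\<close>. The name of \<open>c\<close> may be reused from \<open>S\<close>, so that
  contractions exist even when the vertex type has no vertices to spare; up to isomorphism the
  choice is irrelevant.
\<close>

definition contract :: "'a pair_pre_digraph \<Rightarrow> 'a set \<Rightarrow> 'a \<Rightarrow> 'a pair_pre_digraph" where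
  "contract G S c = (let f = (\<lambda>v. if v \<in> S then c else v) in
     \<lparr> pverts = insert c (pverts G - S),
       parcs = {(f u, f v) |u v. (u, v) \<in> parcs G \<and> f u \<noteq> f v} \<rparr>)"

definition add_pendant :: "'a pair_pre_digraph \<Rightarrow> 'a \<Rightarrow> 'a \<Rightarrow> 'a pair_pre_digraph" where
  "add_pendant G c c' =
     \<lparr> pverts = insert c' (pverts G), parcs = parcs G \<union> {(c, c'), (c', c)} \<rparr>"

inductive_set edge_contractions :: "'a pair_pre_digraph \<Rightarrow> 'a pair_pre_digraph set"
  for G :: "'a pair_pre_digraph" where
  refl: "G \<in> edge_contractions G"
| step: "\<lbrakk> H \<in> edge_contractions G; (u, v) \<in> parcs H; c \<notin> pverts H - {u, v} \<rbrakk>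
    \<Longrightarrow> contract H {u, v} c \<in> edge_contractions G"

inductive_set pendant_contractions :: "'a pair_pre_digraph \<Rightarrow> 'a pair_pre_digraph set"
  for G :: "'a pair_pre_digraph" where
  refl: "G \<in> pendant_contractions G"
| step: "\<lbrakk> H \<in> pendant_contractions G;
      pair_graph C; subgraph (with_proj C) (with_proj H);
      Digraph_Component.connected (with_proj C); card (pverts C) \<ge> 2;
      c \<notin> pverts H - pverts C; c' \<notin> pverts H - pverts C; c \<noteq> c' \<rbrakk>
    \<Longrightarrow> add_pendant (contract H (pverts C) c) c c' \<in> pendant_contractions G"

text \<open>
  The two families may be infinite, since they are closed under the choice of new vertex names,
  but they realise only finitely many values of \<open>mis\<close>, so the maxima over them are well defined.
\<close>

lemma pair_graph_iff:
  "pair_graph G \<longleftrightarrow> finite (pverts G) \<and> parcs G \<subseteq> pverts G \<times> pverts G \<and> sym (parcs G) \<and> irrefl (parcs G)"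
proof
  assume "pair_graph G"
  then interpret pair_graph G .
  show "finite (pverts G) \<and> parcs G \<subseteq> pverts G \<times> pverts G \<and> sym (parcs G) \<and> irrefl (parcs G)"
    using pair_finite_verts pair_sym_arcs
    by (auto simp: irrefl_def symmetric_def dest: in_arcsD1 in_arcsD2 pair_no_loops)
next
  assume "finite (pverts G) \<and> parcs G \<subseteq> pverts G \<times> pverts G \<and> sym (parcs G) \<and> irrefl (parcs G)"
  then have "finite (pverts G)" "parcs G \<subseteq> pverts G \<times> pverts G" "sym (parcs G)"
    and irrefl: "\<And>u. (u, u) \<notin> parcs G"
    by (simp_all add: irrefl_def)
  moreover from this have "finite (parcs G)"
    by (auto intro: finite_subset[where B = "pverts G \<times> pverts G"])
  moreover have "fst e \<noteq> snd e" if "e \<in> parcs G" for e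
    using that irrefl[of "fst e"] by (cases e) auto
  ultimately show "pair_graph G"
    by unfold_locales (auto simp: symmetric_def)
qed

lemma pair_graph_contract:
  assumes "pair_graph G"
  shows "pair_graph (contract G S c)"
  using assms unfolding pair_graph_iff contract_def Let_def sym_def irrefl_def
  by (auto split: if_splits) blast+

lemma pair_graph_add_pendant:
  assumes "pair_graph G" "c \<in> pverts G" "c \<noteq> c'"
  shows "pair_graph (add_pendant G c c')"
  using assms unfolding pair_graph_iff add_pendant_def sym_def irrefl_def by auto

lemma mis_le:
  assumes "finite (pverts G)"
  shows "mis G \<le> 2 ^ card (pverts G)"
proof -
  have "mis G \<le> card (Pow (pverts G))"
    unfolding mis_def using assms
    by (intro card_mono) (auto simp: maximal_independent_set_def independent_set_def)
  then show ?thesis by (simp add: card_Pow assms)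
qed

lemma card_insert_Diff_le:
  assumes "finite V" "S \<subseteq> V" "finite N" "card N \<le> card S"
  shows "card (N \<union> (V - S)) \<le> card V"
proof -
  have "card (N \<union> (V - S)) \<le> card N + card (V - S)" by (rule card_Un_le)
  also have "\<dots> \<le> card V"
    using assms card_mono[of V S] by (simp add: card_Diff_subset finite_subset)
  finally show ?thesis .
qed

lemma edge_contractions_wf:
  assumes "pair_graph G" "H \<in> edge_contractions G"
  shows "pair_graph H \<and> card (pverts H) \<le> card (pverts G)"
  using assms(2)
proof induction
  case refl
  then show ?case using assms(1) by simp
next
  case (step H u v c)
  then have uv: "finite (pverts H)" "{u, v} \<subseteq> pverts H" "u \<noteq> v"
    by (auto simp: pair_graph_iff irrefl_def)
  have "card ({c} \<union> (pverts H - {u, v})) \<le> card (pverts H)"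
    by (rule card_insert_Diff_le) (use uv in auto)
  then show ?case using step pair_graph_contract[of H "{u, v}" c] by (simp add: contract_def Let_def)
qed

lemma pendant_contractions_wf:
  assumes "pair_graph G" "H \<in> pendant_contractions G"
  shows "pair_graph H \<and> card (pverts H) \<le> card (pverts G)"
  using assms(2)
proof induction
  case refl
  then show ?case using assms(1) by simp
next
  case (step H C c c')
  let ?H = "contract H (pverts C) c"
  have "pverts C \<subseteq> pverts H" using step by (auto simp: subgraph_def)
  then have "card ({c', c} \<union> (pverts H - pverts C)) \<le> card (pverts H)"
    using step by (intro card_insert_Diff_le) (auto simp: pair_graph_iff)
  moreover have "pair_graph (add_pendant ?H c c')"
    using step pair_graph_contract[of H "pverts C" c]
    by (intro pair_graph_add_pendant) (auto simp: contract_def Let_def)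
  ultimately show ?case using step by (simp add: add_pendant_def contract_def Let_def)
qed

lemma finite_mis_image:
  assumes "\<And>H. H \<in> \<H> \<Longrightarrow> pair_graph H \<and> card (pverts H) \<le> n"
  shows "finite (mis ` \<H>)"
proof (rule finite_subset)
  show "mis ` \<H> \<subseteq> {.. 2 ^ n}"
  proof
    fix k assume "k \<in> mis ` \<H>"
    then obtain H where H: "H \<in> \<H>" "k = mis H" by blast
    have "mis H \<le> 2 ^ card (pverts H)" using assms[OF H(1)] by (intro mis_le) (simp add: pair_graph_iff)
    also have "\<dots> \<le> 2 ^ n" using assms[OF H(1)] by (intro power_increasing) auto
    finally show "k \<in> {.. 2 ^ n}" using H by simp
  qed
qed simp

lemma finite_mis_edge_contractions:
  "pair_graph G \<Longrightarrow> finite (mis ` edge_contractions G)"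
  by (rule finite_mis_image) (rule edge_contractions_wf)

lemma finite_mis_pendant_contractions:
  "pair_graph G \<Longrightarrow> finite (mis ` pendant_contractions G)"
  by (rule finite_mis_image) (rule pendant_contractions_wf)

lemma finite_C4_private_matchings:
  assumes "pair_graph G"
  shows "finite {M. C4_private_matching G M}"
proof (rule finite_subset)
  show "{M. C4_private_matching G M} \<subseteq> Pow (Pow (pverts G))"
    using assms by (fastforce simp: C4_private_matching_def matching_def uedges_def pair_graph_iff)
  show "finite (Pow (Pow (pverts G)))" using assms by (simp add: pair_graph_iff)
qed

end

theory Submission
  imports Defs
begin

text \<open>
  A graph in \<open>\<H>'(G)\<close> amounts to a family of disjoint connected blocks of at least two vertices
  of \<open>G\<close>, each contracted and given a pendant vertex. Its maximal independent sets correspond to vertex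
  sets of \<open>G\<close> that contain each block entirely or not at all, are independent apart from edges inside
  blocks, and dominate every vertex outside the blocks; the pendant vertices are why an unselected block need
  not be dominated. Counting these sets, a block can be shrunk vertex by vertex to a single edge without
  decreasing the count, so we may assume that the blocks form a matching \<open>M\<close>. Dropping an edge from
  \<open>M\<close> costs a factor of at most \<open>3/2\<close>, and costs nothing unless the edge lies in an
  induced \<open>C\<^sub>4\<close> containing no other edge of \<open>M\<close>. Dropping the free edges first leaves a
  matching with at most \<open>m(G)\<close> edges. For the middle inequality, a graph in \<open>\<H>(G)\<close> becomes
  one in \<open>\<H>'(G)\<close> by attaching pendant vertices, which does not decrease the count.
\<close>

subsection \<open>Maximal independent sets relative to a family of blocks\<close>

definition block_independent :: "'a pair_pre_digraph \<Rightarrow> 'a set set \<Rightarrow> 'a set \<Rightarrow> bool" where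
  "block_independent G \<B> X \<longleftrightarrow> X \<subseteq> pverts G
     \<and> (\<forall>u\<in>X. \<forall>v\<in>X. (u, v) \<in> parcs G \<longrightarrow> (\<exists>B\<in>\<B>. u \<in> B \<and> v \<in> B))
     \<and> (\<forall>B\<in>\<B>. B \<subseteq> X \<or> B \<inter> X = {})"

definition undominated :: "'a pair_pre_digraph \<Rightarrow> 'a set set \<Rightarrow> 'a set \<Rightarrow> 'a set" where
  "undominated G \<B> X = {w \<in> pverts G - X - \<Union>\<B>. \<forall>x\<in>X. (x, w) \<notin> parcs G}"

definition block_mis :: "'a pair_pre_digraph \<Rightarrow> 'a set set \<Rightarrow> 'a set set" where
  "block_mis G \<B> = {X. block_independent G \<B> X \<and> undominated G \<B> X = {}}"

lemma block_independentI:
  assumes "X \<subseteq> pverts G"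
    and "\<And>u v. u \<in> X \<Longrightarrow> v \<in> X \<Longrightarrow> (u, v) \<in> parcs G \<Longrightarrow> \<exists>B\<in>\<B>. u \<in> B \<and> v \<in> B"
    and "\<And>B. B \<in> \<B> \<Longrightarrow> B \<subseteq> X \<or> B \<inter> X = {}"
  shows "block_independent G \<B> X"
  using assms by (simp add: block_independent_def)

lemma block_independentD:
  assumes "block_independent G \<B> X"
  shows "X \<subseteq> pverts G"
    and "\<And>u v. u \<in> X \<Longrightarrow> v \<in> X \<Longrightarrow> (u, v) \<in> parcs G \<Longrightarrow> \<exists>B\<in>\<B>. u \<in> B \<and> v \<in> B"
    and "\<And>B. B \<in> \<B> \<Longrightarrow> B \<subseteq> X \<or> B \<inter> X = {}"
  using assms by (auto simp: block_independent_def)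

lemma block_misD:
  assumes "X \<in> block_mis G \<B>"
  shows "X \<subseteq> pverts G"
    and "\<And>u v. u \<in> X \<Longrightarrow> v \<in> X \<Longrightarrow> (u, v) \<in> parcs G \<Longrightarrow> \<exists>B\<in>\<B>. u \<in> B \<and> v \<in> B"
    and "\<And>B. B \<in> \<B> \<Longrightarrow> B \<subseteq> X \<or> B \<inter> X = {}"
    and "\<And>w. w \<in> pverts G \<Longrightarrow> w \<notin> X \<Longrightarrow> w \<notin> \<Union>\<B> \<Longrightarrow> \<exists>x\<in>X. (x, w) \<in> parcs G"
  using assms by (auto simp: block_mis_def block_independent_def undominated_def)

text \<open>When the blocks change from \<open>\<C>\<close> to \<open>\<B>\<close>, only vertices
  that were in a block and no longer are can lack a neighbour in \<open>X\<close>. A completion of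
  \<open>X\<close> for the new blocks therefore adds nothing else.\<close>

lemma undominated_subset:
  assumes "X \<in> block_mis G \<C>"
  shows "undominated G \<B> X \<subseteq> \<Union>\<C> - \<Union>\<B>"
  using block_misD(4)[OF assms] by (fastforce simp: undominated_def)

context pair_graph
begin

lemma parc_sym: "(u, v) \<in> parcs G \<Longrightarrow> (v, u) \<in> parcs G"
  and parc_irrefl: "(u, u) \<notin> parcs G"
  and parc_pverts: "(u, v) \<in> parcs G \<Longrightarrow> u \<in> pverts G \<and> v \<in> pverts G"
  and pverts_finite: "finite (pverts G)"
  using pair_graph_axioms by (auto simp: pair_graph_iff sym_def irrefl_def)

lemma finite_block_mis: "finite (block_mis G \<B>)"
  by (rule finite_subset[of _ "Pow (pverts G)"])
    (auto simp: block_mis_def block_independent_def pverts_finite)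

lemma block_mis_empty: "block_mis G {} = {I. maximal_independent_set G I}"
proof (intro equalityI subsetI CollectI)
  fix I assume "I \<in> block_mis G {}"
  then have I: "I \<subseteq> pverts G" "\<And>u v. u \<in> I \<Longrightarrow> v \<in> I \<Longrightarrow> (u, v) \<notin> parcs G"
    and dom: "\<And>w. w \<in> pverts G - I \<Longrightarrow> \<exists>x\<in>I. (x, w) \<in> parcs G"
    by (auto simp: block_mis_def block_independent_def undominated_def)
  then show "maximal_independent_set G I"
    unfolding maximal_independent_set_def independent_set_def by blast
next
  fix I assume "I \<in> {I. maximal_independent_set G I}"
  then have I: "independent_set G I" and max: "\<And>J. independent_set G J \<Longrightarrow> I \<subseteq> J \<Longrightarrow> J = I"
    by (auto simp: maximal_independent_set_def)
  have "\<exists>x\<in>I. (x, w) \<in> parcs G" if "w \<in> pverts G - I" for w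
  proof (rule ccontr)
    assume "\<not> ?thesis"
    then have w: "(x, w) \<notin> parcs G" "(w, x) \<notin> parcs G" if "x \<in> I" for x
      using that parc_sym by blast+
    then have "independent_set G (insert w I)"
      using I \<open>w \<in> pverts G - I\<close> parc_irrefl by (auto simp: independent_set_def)
    from max[OF this] that show False by auto
  qed
  then show "I \<in> block_mis G {}"
    using I unfolding block_mis_def block_independent_def undominated_def independent_set_def by blast
qed

lemma mis_eq_card_block_mis: "mis G = card (block_mis G {})"
  by (simp add: mis_def block_mis_empty)

text \<open>A maximal independent subset \<open>I\<close> of the undominated vertices suffices: its
  vertices lie outside all blocks and have no neighbour in \<open>X\<close>. The location of
  \<open>I\<close> is what matters later: the counting maps are surjections, and most preimages of a
  set are found by completing it, if need be after dropping a vertex.\<close>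

lemma block_independent_completion:
  assumes "block_independent G \<B> X"
  obtains I where "X \<union> I \<in> block_mis G \<B>" "I \<subseteq> undominated G \<B> X"
proof -
  define S where "S = {I. I \<subseteq> undominated G \<B> X \<and> (\<forall>a\<in>I. \<forall>b\<in>I. (a, b) \<notin> parcs G)}"
  have "S \<subseteq> Pow (pverts G)" by (auto simp: S_def undominated_def)
  then have "finite S" using pverts_finite finite_subset by blast
  moreover have "{} \<in> S" by (simp add: S_def)
  ultimately obtain I where I: "I \<in> S" and max: "\<And>J. J \<in> S \<Longrightarrow> I \<subseteq> J \<Longrightarrow> I = J"
    using finite_has_maximal[of S] by blast
  have IU: "I \<subseteq> undominated G \<B> X" using I by (simp add: S_def)
  have "block_independent G \<B> (X \<union> I)"
  proof (rule block_independentI)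
    show "X \<union> I \<subseteq> pverts G"
      using assms IU by (auto simp: block_independent_def undominated_def)
    show "\<exists>B\<in>\<B>. u \<in> B \<and> v \<in> B" if "u \<in> X \<union> I" "v \<in> X \<union> I" "(u, v) \<in> parcs G" for u v
    proof -
      have "(x, w) \<notin> parcs G" "(w, x) \<notin> parcs G" if "x \<in> X" "w \<in> I" for x w
        using that IU parc_sym unfolding undominated_def by blast+
      moreover have "(x, w) \<notin> parcs G" if "x \<in> I" "w \<in> I" for x w
        using that I by (simp add: S_def)
      ultimately have "u \<in> X" "v \<in> X" using that by auto
      then show ?thesis using block_independentD(2)[OF assms] that(3) by simp
    qed
    show "B \<subseteq> X \<union> I \<or> B \<inter> (X \<union> I) = {}" if "B \<in> \<B>" for B
    proof -
      have "B \<inter> I = {}" using that IU by (auto simp: undominated_def)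
      moreover have "B \<subseteq> X \<or> B \<inter> X = {}" using block_independentD(3)[OF assms that] .
      ultimately show ?thesis by auto
    qed
  qed
  moreover have False if w: "w \<in> undominated G \<B> (X \<union> I)" for w
  proof -
    have "(x, w) \<notin> parcs G" "(w, x) \<notin> parcs G" if "x \<in> I" for x
      using that w parc_sym unfolding undominated_def by blast+
    moreover have "w \<in> undominated G \<B> X" using w by (simp add: undominated_def)
    ultimately have "insert w I \<in> S" using I parc_irrefl by (auto simp: S_def)
    from max[OF this] w show False by (auto simp: undominated_def)
  qed
  ultimately have "X \<union> I \<in> block_mis G \<B>" by (auto simp: block_mis_def)
  then show ?thesis using that IU by blast
qed

text \<open>The images under \<open>\<Psi>\<close> of the family for \<open>C\<close> cover the
  family for \<open>insert v C\<close>. A set \<open>X\<close> without \<open>v\<close> gains at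
  most \<open>v\<close> on completion. From a set \<open>X\<close> with \<open>v\<close>, drop
  \<open>v\<close> and complete: the neighbour \<open>c\<close> keeps \<open>v\<close> out, and the
  added vertices are neighbours of \<open>v\<close> outside \<open>C\<close>. As \<open>X\<close>
  has no such vertices, they can be recognised and removed. Whether the preimage meets
  \<open>C\<close> tells the two cases apart.\<close>

lemma card_block_mis_shrink:
  assumes disj: "insert v C \<inter> \<Union>\<B> = {}" and "v \<notin> C" and cv: "c \<in> C" "(c, v) \<in> parcs G"
  shows "card (block_mis G (insert (insert v C) \<B>)) \<le> card (block_mis G (insert C \<B>))"
proof -
  define N where "N = {w. (v, w) \<in> parcs G}"
  define \<Psi> where "\<Psi> Y = (if Y \<inter> C = {} then Y - {v} else insert v (Y - (N - C)))" for Y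
  have "X \<in> \<Psi> ` block_mis G (insert C \<B>)"
    if X: "X \<in> block_mis G (insert (insert v C) \<B>)" for X
  proof (cases "v \<in> X")
    case False
    then have XC: "X \<inter> insert v C = {}"
      using block_misD(3)[OF X, of "insert v C"] by auto
    have "block_independent G (insert C \<B>) X"
    proof (rule block_independentI)
      show "\<exists>B\<in>insert C \<B>. a \<in> B \<and> b \<in> B" if "a \<in> X" "b \<in> X" "(a, b) \<in> parcs G" for a b
        using block_misD(2)[OF X that] XC that(1) by auto
    qed (use block_misD(1,3)[OF X] XC in auto)
    then obtain I where Y: "X \<union> I \<in> block_mis G (insert C \<B>)" and I: "I \<subseteq> undominated G (insert C \<B>) X"
      by (rule block_independent_completion)
    have "I \<subseteq> {v}"
      using I undominated_subset[OF X, of "insert C \<B>"] by auto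
    then have "\<Psi> (X \<union> I) = X" using XC \<open>v \<notin> C\<close> by (auto simp: \<Psi>_def)
    with Y show ?thesis by (metis image_eqI)
  next
    case True
    then have XC: "insert v C \<subseteq> X"
      using block_misD(3)[OF X, of "insert v C"] by auto
    have indep: "\<And>a b. a \<in> X \<Longrightarrow> b \<in> X \<Longrightarrow> (a, b) \<in> parcs G \<Longrightarrow> a \<notin> insert v C \<Longrightarrow> \<exists>B\<in>\<B>. a \<in> B \<and> b \<in> B"
      using block_misD(2)[OF X] by blast
    have "block_independent G (insert C \<B>) (X - {v})"
    proof (rule block_independentI)
      show "\<exists>B\<in>insert C \<B>. a \<in> B \<and> b \<in> B"
        if "a \<in> X - {v}" "b \<in> X - {v}" "(a, b) \<in> parcs G" for a b
        using block_misD(2)[OF X _ _ that(3)] that by blast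
      show "B \<subseteq> X - {v} \<or> B \<inter> (X - {v}) = {}" if "B \<in> insert C \<B>" for B
      proof (cases "B = C")
        case False
        then have "B \<in> \<B>" using that by blast
        then show ?thesis using block_misD(3)[OF X, of B] disj by blast
      qed (use XC \<open>v \<notin> C\<close> in blast)
    qed (use block_misD(1)[OF X] in blast)
    then obtain I where Y: "X - {v} \<union> I \<in> block_mis G (insert C \<B>)"
        and I: "I \<subseteq> undominated G (insert C \<B>) (X - {v})"
      by (rule block_independent_completion)
    have vI: "v \<notin> I"
      using I XC cv \<open>v \<notin> C\<close> unfolding undominated_def by blast
    have IX: "I \<inter> X = {}" using I vI unfolding undominated_def by blast
    \<comment> \<open>Each vertex of \<open>I\<close> has a neighbour in \<open>X\<close> but none
      in \<open>X - {v}\<close>, so that neighbour is \<open>v\<close>.\<close>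
    have IN: "I \<subseteq> N"
    proof
      fix w assume w: "w \<in> I"
      have "w \<notin> \<Union>(insert (insert v C) \<B>)" "w \<in> pverts G"
        using w vI I unfolding undominated_def by auto
      then obtain x where "x \<in> X" "(x, w) \<in> parcs G"
        using block_misD(4)[OF X, of w] w IX by blast
      then show "w \<in> N" using w I unfolding undominated_def N_def by blast
    qed
    have IC: "I \<inter> C = {}" using I unfolding undominated_def by blast
    have XN: "w \<in> C" if "w \<in> X" "w \<in> N" for w
      using indep[of w v] that XC disj parc_sym[of v w] parc_irrefl[of v] unfolding N_def by blast
    have "\<Psi> (X - {v} \<union> I) = X"
      using IN IX IC XN XC cv \<open>v \<notin> C\<close> unfolding \<Psi>_def by auto
    with Y show ?thesis by (metis image_eqI)
  qed
  then show ?thesis using surj_card_le[OF finite_block_mis, of _ \<Psi>] by blast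
qed

section \<open>Removing a block that is a single edge\<close>

lemma block_independent_minus:
  assumes X: "X \<in> block_mis G (insert {u, v} \<B>)" "u \<in> X"
    and disj: "{u, v} \<inter> \<Union>\<B> = {}"
  shows "block_independent G \<B> (X - {v})"
proof (rule block_independentI)
  show "X - {v} \<subseteq> pverts G" using block_misD(1)[OF X(1)] by blast
  show "\<exists>B\<in>\<B>. a \<in> B \<and> b \<in> B" if "a \<in> X - {v}" "b \<in> X - {v}" "(a, b) \<in> parcs G" for a b
    using block_misD(2)[OF X(1), of a b] that parc_irrefl by blast
  show "B \<subseteq> X - {v} \<or> B \<inter> (X - {v}) = {}" if "B \<in> \<B>" for B
    using block_misD(3)[OF X(1), of B] that disj by blast
qed

lemma block_independent_restrict:
  assumes X: "X \<in> block_mis G (insert C \<B>)" and "X \<inter> C = {}"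
  shows "block_independent G \<B> X"
proof (rule block_independentI)
  show "\<exists>B\<in>\<B>. a \<in> B \<and> b \<in> B" if "a \<in> X" "b \<in> X" "(a, b) \<in> parcs G" for a b
    using block_misD(2)[OF X that] assms(2) that(1) by auto
qed (use block_misD(1,3)[OF X] in auto)

text \<open>The vertex \<open>u\<close> keeps \<open>v\<close> out of \<open>I\<close>, and all of
  \<open>I\<close> is adjacent to \<open>v\<close>, since its vertices are dominated by
  \<open>X\<close> but not by \<open>X - {v}\<close>. As \<open>u\<close> is the only neighbour of
  \<open>v\<close> in \<open>X\<close>, deleting the neighbours of \<open>v\<close> removes exactly
  \<open>I\<close> and \<open>u\<close>.\<close>

lemma recover_block:
  assumes X: "X \<in> block_mis G (insert {u, v} \<B>)" "u \<in> X"
    and uv: "(u, v) \<in> parcs G" and disj: "{u, v} \<inter> \<Union>\<B> = {}"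
    and I: "I \<subseteq> undominated G \<B> (X - {v})"
  shows "insert u (insert v (X - {v} \<union> I - {w. (v, w) \<in> parcs G})) = X"
proof -
  have vX: "v \<in> X" using block_misD(3)[OF X(1), of "{u, v}"] X(2) by auto
  have "u \<noteq> v" using uv parc_irrefl by blast
  then have "v \<notin> I" using I X uv unfolding undominated_def by blast
  have "(v, w) \<in> parcs G" if w: "w \<in> I" for w
  proof -
    have "w \<noteq> u" using w I X \<open>u \<noteq> v\<close> unfolding undominated_def by blast
    then have "w \<notin> \<Union>(insert {u, v} \<B>)" "w \<in> pverts G" "w \<notin> X"
      using w \<open>v \<notin> I\<close> I unfolding undominated_def by auto
    then obtain x where "x \<in> X" "(x, w) \<in> parcs G"
      using block_misD(4)[OF X(1)] by blast
    then show ?thesis using w I unfolding undominated_def by blast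
  qed
  moreover have "w \<in> {u, v}" if "w \<in> X" "(v, w) \<in> parcs G" for w
    using block_misD(2)[OF X(1) vX that] disj by blast
  ultimately show ?thesis using vX X by blast
qed

text \<open>Sets that avoid the edge number at most \<open>card (block_mis G \<B>)\<close>, sets
  that contain it at most half of that: there are no more of them than members of
  \<open>block_mis G \<B>\<close> containing \<open>u\<close>, nor than members containing
  \<open>v\<close>, and no member contains both. Together this gives the factor 3/2.\<close>

lemma card_block_mis_remove_edge:
  assumes uv: "(u, v) \<in> parcs G" and disj: "{u, v} \<inter> \<Union>\<B> = {}"
  shows "2 * card (block_mis G (insert {u, v} \<B>)) \<le> 3 * card (block_mis G \<B>)"
proof -
  let ?F = "block_mis G (insert {u, v} \<B>)" and ?F' = "block_mis G \<B>"
  have "u \<noteq> v" using uv parc_irrefl by blast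
  have "{X \<in> ?F. u \<notin> X} \<subseteq> (\<lambda>Y. Y - {u, v}) ` ?F'"
  proof
    fix X assume X: "X \<in> {X \<in> ?F. u \<notin> X}"
    then have Xuv: "X \<inter> {u, v} = {}" using block_misD(3)[of X G "insert {u, v} \<B>" "{u, v}"] by auto
    then have "block_independent G \<B> X" using X block_independent_restrict by blast
    then obtain I where "X \<union> I \<in> ?F'" and I: "I \<subseteq> undominated G \<B> X"
      by (rule block_independent_completion)
    moreover have "I \<subseteq> {u, v}"
      using I X undominated_subset[of X G "insert {u, v} \<B>" \<B>] by auto
    then have "X \<union> I - {u, v} = X" using Xuv by blast
    ultimately show "X \<in> (\<lambda>Y. Y - {u, v}) ` ?F'"
      by (intro image_eqI[where x = "X \<union> I"]) simp_all
  qed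
  then have A: "card {X \<in> ?F. u \<notin> X} \<le> card ?F'"
    using surj_card_le[OF finite_block_mis] by blast
  \<comment> \<open>Each set containing \<open>u\<close> and \<open>v\<close> arises from a set that keeps only \<open>u\<close> and from one that keeps only \<open>v\<close>.\<close>
  have half: "card {X \<in> ?F. a \<in> X} \<le> card {Y \<in> ?F'. a \<in> Y}" if ab: "{a, b} = {u, v}" "(a, b) \<in> parcs G" for a b
  proof (rule surj_card_le)
    show "finite {Y \<in> ?F'. a \<in> Y}" by (simp add: finite_block_mis)
    show "{X \<in> ?F. a \<in> X} \<subseteq> (\<lambda>Y. insert a (insert b (Y - {w. (b, w) \<in> parcs G}))) ` {Y \<in> ?F'. a \<in> Y}"
    proof
      fix X assume "X \<in> {X \<in> ?F. a \<in> X}"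
      then have X: "X \<in> block_mis G (insert {a, b} \<B>)" "a \<in> X" using ab by auto
      have d: "{a, b} \<inter> \<Union>\<B> = {}" using disj ab by simp
      obtain I where "X - {b} \<union> I \<in> ?F'" "I \<subseteq> undominated G \<B> (X - {b})"
        using block_independent_minus[OF X d] by (rule block_independent_completion)
      moreover have "a \<noteq> b" using ab parc_irrefl by blast
      ultimately show "X \<in> (\<lambda>Y. insert a (insert b (Y - {w. (b, w) \<in> parcs G}))) ` {Y \<in> ?F'. a \<in> Y}"
        using recover_block[OF X ab(2) d] X(2) by (intro image_eqI[where x = "X - {b} \<union> I"]) auto
    qed
  qed
  have eq: "{X \<in> ?F. v \<in> X} = {X \<in> ?F. u \<in> X}"
    using block_misD(3)[of _ G "insert {u, v} \<B>" "{u, v}"] by auto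
  have "{Y \<in> ?F'. u \<in> Y} \<inter> {Y \<in> ?F'. v \<in> Y} = {}"
    using uv disj block_misD(2)[of _ G \<B> u v] by blast
  then have "card {Y \<in> ?F'. u \<in> Y} + card {Y \<in> ?F'. v \<in> Y} = card ({Y \<in> ?F'. u \<in> Y} \<union> {Y \<in> ?F'. v \<in> Y})"
    by (simp add: card_Un_disjoint finite_block_mis)
  also have "\<dots> \<le> card ?F'" by (intro card_mono finite_block_mis) auto
  finally have B: "2 * card {X \<in> ?F. u \<in> X} \<le> card ?F'"
    using half[OF HOL.refl uv] half[OF insert_commute parc_sym[OF uv]] eq by simp
  have F: "{X \<in> ?F. u \<in> X} \<union> {X \<in> ?F. u \<notin> X} = ?F" by auto
  have "card ?F \<le> card {X \<in> ?F. u \<in> X} + card {X \<in> ?F. u \<notin> X}"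
    using card_Un_le[of "{X \<in> ?F. u \<in> X}" "{X \<in> ?F. u \<notin> X}"] unfolding F .
  with A B show ?thesis by linarith
qed

text \<open>In \<open>no_C4\<close> the vertices \<open>u\<close>, \<open>v\<close>,
  \<open>z\<close>, \<open>w\<close> form an induced 4-cycle. The argument meets such a cycle only
  with \<open>z\<close> and \<open>w\<close> both undominated by some set, hence outside all blocks
  of \<open>\<B>\<close>, so it is enough that one of the two be covered.\<close>

lemma card_block_mis_remove_edge_no_C4:
  assumes uv: "(u, v) \<in> parcs G" and disj: "{u, v} \<inter> \<Union>\<B> = {}"
    and no_C4: "\<And>z w. (v, z) \<in> parcs G \<Longrightarrow> (z, w) \<in> parcs G \<Longrightarrow> (w, u) \<in> parcs G \<Longrightarrow>
      (u, z) \<notin> parcs G \<Longrightarrow> (v, w) \<notin> parcs G \<Longrightarrow> z \<noteq> u \<Longrightarrow> w \<noteq> v \<Longrightarrow>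
      z \<in> \<Union>\<B> \<or> w \<in> \<Union>\<B>"
  shows "card (block_mis G (insert {u, v} \<B>)) \<le> card (block_mis G \<B>)"
proof -
  let ?F = "block_mis G (insert {u, v} \<B>)"
  define N where "N a = {w. (a, w) \<in> parcs G}" for a
  \<comment> \<open>A set avoiding \<open>u\<close> is hit by adding \<open>u\<close>, failing that \<open>v\<close>, where undominated. A set \<open>X\<close>
    containing \<open>u\<close> and \<open>v\<close> is hit by dropping \<open>u\<close> or by replacing \<open>v\<close> with some of its neighbours;
    both fail only if neighbours of \<open>u\<close> and of \<open>v\<close> close up an induced \<open>C\<^sub>4\<close>.\<close>
  define \<Psi> where "\<Psi> Y =
    (if u \<in> Y then if Y - {u} \<in> ?F then Y - {u} else insert u (insert v (Y - N v))
     else if v \<in> Y then if N u \<inter> Y \<subseteq> {v} then insert u Y else Y - {v}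
     else Y)" for Y
  have "u \<noteq> v" using uv parc_irrefl by blast
  have vu: "(v, u) \<in> parcs G" using uv parc_sym by blast
  have "X \<in> \<Psi> ` block_mis G \<B>" if X: "X \<in> ?F" for X
  proof (cases "u \<in> X")
    case False
    then have Xuv: "u \<notin> X" "v \<notin> X" using block_misD(3)[OF X, of "{u, v}"] by auto
    then have ind: "block_independent G \<B> X" using X block_independent_restrict by blast
    have und: "undominated G \<B> X \<subseteq> {u, v}"
      using undominated_subset[OF X, of \<B>] by auto
    have ins: "insert a X \<in> block_mis G \<B>"
      if "N a \<inter> X = {}" "{a, b} = {u, v}" "(a, b) \<in> parcs G" "a \<noteq> b" for a b
    proof -
      have "a \<notin> \<Union>\<B>" using that disj by blast
      have nadj: "(a, x) \<notin> parcs G" "(x, a) \<notin> parcs G" if "x \<in> insert a X" for x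
        using that \<open>N a \<inter> X = {}\<close> parc_sym parc_irrefl unfolding N_def by blast+
      have "block_independent G \<B> (insert a X)"
      proof (rule block_independentI)
        show "insert a X \<subseteq> pverts G" using parc_pverts[OF that(3)] block_misD(1)[OF X] by blast
        show "\<exists>B\<in>\<B>. x \<in> B \<and> y \<in> B" if "x \<in> insert a X" "y \<in> insert a X" "(x, y) \<in> parcs G" for x y
        proof -
          have "x \<in> X" "y \<in> X" using that nadj by blast+
          then show ?thesis using block_independentD(2)[OF ind] that(3) by simp
        qed
        show "B \<subseteq> insert a X \<or> B \<inter> insert a X = {}" if "B \<in> \<B>" for B
          using block_independentD(3)[OF ind that] that \<open>a \<notin> \<Union>\<B>\<close> by blast
      qed
      moreover have "undominated G \<B> (insert a X) = {}"
        using und that unfolding undominated_def by blast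
      ultimately show ?thesis by (simp add: block_mis_def)
    qed
    \<comment> \<open>The order matters: \<open>v\<close> is added only if \<open>u\<close> has a
      neighbour in \<open>X\<close>. This neighbour differs from \<open>v\<close>, so
      \<open>N u \<inter> Y \<subseteq> {v}\<close> fails and \<open>\<Psi>\<close> removes
      \<open>v\<close> instead of inserting \<open>u\<close>.\<close>
    consider "N u \<inter> X = {}" | "N u \<inter> X \<noteq> {}" "N v \<inter> X = {}" | "N u \<inter> X \<noteq> {}" "N v \<inter> X \<noteq> {}" by blast
    then show ?thesis
    proof cases
      case 1
      have "\<Psi> (insert u X) = X" using Xuv X by (simp add: \<Psi>_def)
      then show ?thesis using ins[OF 1 _ uv \<open>u \<noteq> v\<close>] by (metis image_eqI)
    next
      case 2
      have "\<Psi> (insert v X) = X" using Xuv 2 \<open>u \<noteq> v\<close> by (auto simp: \<Psi>_def)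
      then show ?thesis using ins[OF 2(2) _ vu] \<open>u \<noteq> v\<close> by (metis image_eqI insert_commute)
    next
      case 3
      then have "undominated G \<B> X = {}"
        using und parc_sym unfolding undominated_def N_def by blast
      then have "X \<in> block_mis G \<B>" using ind by (simp add: block_mis_def)
      moreover have "\<Psi> X = X" using Xuv by (simp add: \<Psi>_def)
      ultimately show ?thesis by (metis image_eqI)
    qed
  next
    case True
    then have Xuv: "u \<in> X" "v \<in> X" using block_misD(3)[OF X, of "{u, v}"] by auto
    have nbr: "w \<in> {u, v}" if "w \<in> X" "(u, w) \<in> parcs G" for w
      using block_misD(2)[OF X Xuv(1) that] disj by blast
    show ?thesis
    \<comment> \<open>Such a \<open>w\<close> is what prevents dropping \<open>u\<close> from
      \<open>X\<close>. It also marks the preimage that keeps \<open>u\<close>: once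
      \<open>u\<close> is deleted there, \<open>w\<close> is undominated, which sends
      \<open>\<Psi>\<close> to the branch that restores \<open>v\<close>.\<close>
    proof (cases "\<exists>w. w \<in> undominated G \<B> (X - {u, v}) \<and> (u, w) \<in> parcs G \<and> (v, w) \<notin> parcs G \<and> w \<noteq> v")
      case True
      then obtain w where w: "w \<in> undominated G \<B> (X - {u, v})" "(u, w) \<in> parcs G" "(v, w) \<notin> parcs G" "w \<noteq> v"
        by blast
      obtain I where Y: "X - {v} \<union> I \<in> block_mis G \<B>" and I: "I \<subseteq> undominated G \<B> (X - {v})"
        using block_independent_minus[OF X Xuv(1) disj] by (rule block_independent_completion)
      \<comment> \<open>A neighbour \<open>z\<close> of \<open>w\<close> in \<open>I\<close> would
        be adjacent to \<open>v\<close> but not to \<open>u\<close>, and \<open>u\<close>,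
        \<open>v\<close>, \<open>z\<close>, \<open>w\<close> would form an induced 4-cycle with
        \<open>z\<close> and \<open>w\<close> outside all blocks of \<open>\<B>\<close>.\<close>
      have zw: "(z, w) \<notin> parcs G" if z: "z \<in> I" for z
      proof
        assume "(z, w) \<in> parcs G"
        have "z \<noteq> v" using z I Xuv uv \<open>u \<noteq> v\<close> unfolding undominated_def by blast
        have "z \<noteq> u" using z I Xuv \<open>u \<noteq> v\<close> unfolding undominated_def by blast
        then have "z \<notin> \<Union>(insert {u, v} \<B>)" "z \<in> pverts G" "z \<notin> X"
          using z \<open>z \<noteq> v\<close> I unfolding undominated_def by auto
        then obtain x where "x \<in> X" "(x, z) \<in> parcs G"
          using block_misD(4)[OF X] by blast
        then have "(v, z) \<in> parcs G" using z I unfolding undominated_def by blast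
        have "(u, z) \<notin> parcs G" "z \<notin> \<Union>\<B>"
          using z I Xuv \<open>u \<noteq> v\<close> unfolding undominated_def by blast+
        moreover have "w \<notin> \<Union>\<B>" using w unfolding undominated_def by blast
        ultimately show False
          using no_C4[of z w] w parc_sym[of u w] \<open>(v, z) \<in> parcs G\<close> \<open>(z, w) \<in> parcs G\<close> \<open>z \<noteq> u\<close> by blast
      qed
      have "w \<notin> I" using I w Xuv \<open>u \<noteq> v\<close> unfolding undominated_def by blast
      moreover have "w \<noteq> u" using w parc_irrefl by blast
      ultimately have "w \<in> undominated G (insert {u, v} \<B>) (X - {v} \<union> I - {u})"
        using w zw unfolding undominated_def by blast
      then have "X - {v} \<union> I - {u} \<notin> ?F" by (auto simp: block_mis_def)
      then have "\<Psi> (X - {v} \<union> I) = X"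
        using recover_block[OF X Xuv(1) uv disj I] Xuv \<open>u \<noteq> v\<close> by (simp add: \<Psi>_def N_def)
      with Y show ?thesis by (metis image_eqI)
    next
      case False
      have "block_independent G \<B> (X - {u})"
        using block_independent_minus[of X v u] X Xuv disj by (simp add: insert_commute)
      \<comment> \<open>A vertex left undominated here would be a \<open>w\<close> of the excluded
        kind.\<close>
      moreover have "undominated G \<B> (X - {u}) = {}"
      proof (rule ccontr)
        assume "undominated G \<B> (X - {u}) \<noteq> {}"
        then obtain w where w: "w \<in> undominated G \<B> (X - {u})" by blast
        have wu: "w \<noteq> u" using w Xuv vu \<open>u \<noteq> v\<close> unfolding undominated_def by blast
        moreover have "w \<noteq> v" using w Xuv \<open>u \<noteq> v\<close> unfolding undominated_def by blast
        ultimately have "w \<notin> \<Union>(insert {u, v} \<B>)" "w \<in> pverts G" "w \<notin> X"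
          using w unfolding undominated_def by auto
        then obtain x where "x \<in> X" "(x, w) \<in> parcs G"
          using block_misD(4)[OF X] by blast
        then have "(u, w) \<in> parcs G" using w unfolding undominated_def by blast
        moreover have "(v, w) \<notin> parcs G" using w Xuv \<open>u \<noteq> v\<close> unfolding undominated_def by blast
        moreover have "w \<in> undominated G \<B> (X - {u, v})"
          using w \<open>w \<noteq> v\<close> wu unfolding undominated_def by blast
        ultimately show False using False \<open>w \<noteq> v\<close> by blast
      qed
      ultimately have "X - {u} \<in> block_mis G \<B>" by (simp add: block_mis_def)
      moreover have "N u \<inter> (X - {u}) \<subseteq> {v}" using nbr unfolding N_def by blast
      then have "\<Psi> (X - {u}) = X" using Xuv \<open>u \<noteq> v\<close> unfolding \<Psi>_def by auto
      ultimately show ?thesis by (metis image_eqI)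
    qed
  qed
  then show ?thesis using surj_card_le[OF finite_block_mis, of _ \<Psi>] by blast
qed

end

subsection \<open>From connected blocks to matchings\<close>

text \<open>Connectivity in terms of cuts rather than walks, which suits growing a set vertex by
  vertex and moving a cut between \<open>H\<close> and \<open>G\<close>. The empty set and
  singletons satisfy it vacuously.\<close>

definition connected_in :: "'a pair_pre_digraph \<Rightarrow> 'a set \<Rightarrow> bool" where
  "connected_in G S \<longleftrightarrow> (\<forall>T. T \<subseteq> S \<and> T \<noteq> {} \<and> T \<noteq> S \<longrightarrow> (\<exists>a\<in>T. \<exists>b\<in>S - T. (a, b) \<in> parcs G))"

lemma connected_inD:
  assumes "connected_in G S" "T \<subseteq> S" "T \<noteq> {}" "T \<noteq> S"
  obtains a b where "a \<in> T" "b \<in> S" "b \<notin> T" "(a, b) \<in> parcs G"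
  using assms unfolding connected_in_def by blast

text \<open>If no arc of \<open>H\<close> led from \<open>T\<close> to the rest of
  \<open>pverts C\<close>, a walk of \<open>C\<close> starting in \<open>T\<close> could never leave
  it. The assumed connectivity is strong connectivity of the symmetric closure, which adds no arcs
  to the symmetric \<open>C\<close>.\<close>

lemma connected_in_connected_subgraph:
  assumes C: "pair_graph C" and sub: "subgraph (with_proj C) (with_proj H)"
    and conn: "Digraph_Component.connected (with_proj C)"
  shows "connected_in H (pverts C)"
  unfolding connected_in_def
proof (intro allI impI)
  fix T assume T: "T \<subseteq> pverts C \<and> T \<noteq> {} \<and> T \<noteq> pverts C"
  then obtain a b where ab: "a \<in> T" "b \<in> pverts C" "b \<notin> T" by blast
  interpret C: pair_graph C by (rule C)
  show "\<exists>a\<in>T. \<exists>b\<in>pverts C - T. (a, b) \<in> parcs H"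
  proof (rule ccontr)
    assume no: "\<not> ?thesis"
    have "parcs C \<subseteq> parcs H" using sub by (auto simp: subgraph_def)
    have "strongly_connected (mk_symmetric (with_proj C))"
      using conn by (simp only: Digraph_Component.connected_def)
    moreover have "pverts (mk_symmetric (with_proj C)) = pverts C" by simp
    ultimately have "reachable (mk_symmetric (with_proj C)) a b"
      using ab T unfolding strongly_connected_def with_proj_simps by blast
    then have "(a, b) \<in> rtrancl_on (pverts C) (parcs (mk_symmetric (with_proj C)))"
      by (simp add: reachable_def)
    then have "b \<in> T"
    proof (induction rule: rtrancl_on_induct)
      case base
      then show ?case using ab by simp
    next
      case (step y z)
      have "(y, z) \<in> parcs C"
        using step(2) C.parc_sym[of z y] unfolding parcs_mk_symmetric with_proj_simps by auto
      then have "(y, z) \<in> parcs H" using \<open>parcs C \<subseteq> parcs H\<close> by blast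
      moreover have "z \<in> pverts C" using step(4) by simp
      ultimately show ?case using no step(5) by blast
    qed
    then show False using ab by simp
  qed
qed

context pair_graph
begin

text \<open>The shrinking is read backwards. Start from an edge inside \<open>S\<close> and take a
  maximal \<open>T\<close> between this edge and \<open>S\<close> for which the bound holds. If
  \<open>T\<close> were not \<open>S\<close>, connectivity would supply a vertex of \<open>S\<close>
  outside \<open>T\<close> adjacent to \<open>T\<close>, and \<open>card_block_mis_shrink\<close>
  would extend the bound to it.\<close>

lemma card_block_mis_shrink_to_edge:
  assumes "finite S" and S: "connected_in G S" "2 \<le> card S" and disj: "S \<inter> \<Union>\<B> = {}"
  obtains u v where "u \<in> S" "v \<in> S" "(u, v) \<in> parcs G"
    "card (block_mis G (insert S \<B>)) \<le> card (block_mis G (insert {u, v} \<B>))"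
proof -
  obtain u where u: "u \<in> S" using S(2) by fastforce
  have "{u} \<noteq> S" using S(2) by force
  with u obtain v where v: "v \<in> S" "(u, v) \<in> parcs G"
    using connected_inD[OF S(1), of "{u}"] by blast
  define \<T> where "\<T> = {T. T \<subseteq> S \<and> {u, v} \<subseteq> T
    \<and> card (block_mis G (insert T \<B>)) \<le> card (block_mis G (insert {u, v} \<B>))}"
  have "\<T> \<subseteq> Pow S" by (auto simp: \<T>_def)
  then have "finite \<T>" using \<open>finite S\<close> finite_subset by blast
  moreover have "{u, v} \<in> \<T>" using u v by (auto simp: \<T>_def)
  ultimately obtain T where T: "T \<in> \<T>" and max: "\<And>T'. T' \<in> \<T> \<Longrightarrow> T \<subseteq> T' \<Longrightarrow> T = T'"
    using finite_has_maximal[of \<T>] by blast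
  have "T = S"
  proof (rule ccontr)
    assume "T \<noteq> S"
    with T obtain a b where ab: "a \<in> T" "b \<in> S" "b \<notin> T" "(a, b) \<in> parcs G"
      using connected_inD[OF S(1), of T] by (auto simp: \<T>_def)
    have "insert b T \<inter> \<Union>\<B> = {}" using T ab disj by (auto simp: \<T>_def)
    from card_block_mis_shrink[OF this ab(3,1,4)] have "insert b T \<in> \<T>"
      using T ab by (auto simp: \<T>_def)
    from max[OF this] ab(3) show False by auto
  qed
  with T u v show ?thesis using that by (simp add: \<T>_def)
qed

text \<open>The blocks are processed one at a time: \<open>\<S>\<close> holds those still to be
  shrunk, \<open>\<B>\<close> the edges that have replaced earlier ones. An edge chosen inside its
  block is disjoint from all other blocks, so the edges stay a matching.\<close>

lemma card_block_mis_le_matching: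
  assumes "finite \<S>" and "\<And>S. S \<in> \<S> \<Longrightarrow> finite S \<and> connected_in G S \<and> 2 \<le> card S"
    and "\<And>S S'. S \<in> \<S> \<Longrightarrow> S' \<in> \<S> \<Longrightarrow> S \<noteq> S' \<Longrightarrow> S \<inter> S' = {}"
    and "matching G \<B>" "\<Union>\<S> \<inter> \<Union>\<B> = {}"
  shows "\<exists>M. matching G M \<and> card (block_mis G (\<S> \<union> \<B>)) \<le> card (block_mis G M)"
  using assms
proof (induction \<S> arbitrary: \<B> rule: finite_induct)
  case empty
  then show ?case by auto
next
  case (insert S \<S>)
  have S: "finite S" "connected_in G S" "2 \<le> card S" using insert.prems(1)[of S] by auto
  have disjS: "S \<inter> S' = {}" if "S' \<in> \<S>" for S'
    using insert.prems(2)[of S S'] insert.hyps(2) that by auto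
  have "S \<inter> \<Union>(\<S> \<union> \<B>) = {}" using disjS insert.prems(4) by auto
  then obtain u v where uv: "u \<in> S" "v \<in> S" "(u, v) \<in> parcs G"
    and le: "card (block_mis G (insert S (\<S> \<union> \<B>))) \<le> card (block_mis G (insert {u, v} (\<S> \<union> \<B>)))"
    by (rule card_block_mis_shrink_to_edge[OF S])
  have e: "{u, v} \<inter> f = {}" "f \<inter> {u, v} = {}" if "f \<in> \<B>" for f
    using that uv insert.prems(4) by auto
  have "{u, v} \<in> uedges G" using uv by (auto simp: uedges_def)
  then have "matching G (insert {u, v} \<B>)"
    using insert.prems(3) e unfolding matching_def by simp
  moreover have "\<Union>\<S> \<inter> \<Union>(insert {u, v} \<B>) = {}"
    using insert.prems(4) disjS uv by auto
  ultimately obtain M where "matching G M"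
    "card (block_mis G (\<S> \<union> insert {u, v} \<B>)) \<le> card (block_mis G M)"
    using insert.IH[of "insert {u, v} \<B>"] insert.prems(1,2) by auto
  then show ?case using le by auto
qed

section \<open>Removing the edges of a matching\<close>

lemma finite_matching: "matching G M \<Longrightarrow> finite M"
proof -
  assume "matching G M"
  then have "M \<subseteq> Pow (pverts G)"
    using parc_pverts by (fastforce simp: matching_def uedges_def)
  then show ?thesis using pverts_finite by (auto intro: finite_subset)
qed

lemma matching_Diff: "matching G M \<Longrightarrow> matching G (M - A)"
  unfolding matching_def by auto

lemma matching_edgeE:
  assumes "matching G M" "e \<in> M"
  obtains u v where "e = {u, v}" "(u, v) \<in> parcs G" "{u, v} \<inter> \<Union>(M - {e}) = {}"
proof -
  obtain u v where "e = {u, v}" "(u, v) \<in> parcs G"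
    using assms by (auto simp: matching_def uedges_def)
  moreover have "e \<inter> f = {}" if "f \<in> M - {e}" for f
    using assms that by (auto simp: matching_def)
  then have "e \<inter> \<Union>(M - {e}) = {}" by blast
  ultimately show ?thesis using that by simp
qed

lemma card_block_mis_matching:
  assumes "matching G M"
  shows "real (card (block_mis G M)) \<le> (3 / 2) ^ card M * real (mis G)"
  using finite_matching[OF assms] assms
proof (induction M rule: finite_psubset_induct)
  case (psubset M)
  show ?case
  proof (cases "M = {}")
    case False
    then obtain e where e: "e \<in> M" by blast
    then obtain u v where uv: "e = {u, v}" "(u, v) \<in> parcs G" "{u, v} \<inter> \<Union>(M - {e}) = {}"
      using matching_edgeE[OF psubset.prems] by metis
    have "2 * card (block_mis G (insert {u, v} (M - {e}))) \<le> 3 * card (block_mis G (M - {e}))"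
      by (rule card_block_mis_remove_edge) (use uv in auto)
    moreover have "insert {u, v} (M - {e}) = M" using e uv by auto
    ultimately have "real (card (block_mis G M)) \<le> 3 / 2 * real (card (block_mis G (M - {e})))" by simp
    also have "\<dots> \<le> 3 / 2 * ((3 / 2) ^ card (M - {e}) * real (mis G))"
      using psubset.IH[of "M - {e}"] e matching_Diff[OF psubset.prems] by (intro mult_left_mono) auto
    also have "\<dots> = (3 / 2) ^ card M * real (mis G)"
      using card.remove[OF psubset.hyps e] by simp
    finally show ?thesis .
  qed (simp add: mis_eq_card_block_mis)
qed

lemma induced_C4:
  assumes "distinct [u, v, z, w]" "(u, v) \<in> parcs G" "(v, z) \<in> parcs G" "(z, w) \<in> parcs G" "(w, u) \<in> parcs G"
    and "(u, z) \<notin> parcs G" "(v, w) \<notin> parcs G"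
  obtains Q where "induced_subgraph (with_proj Q) (with_proj G)" "is_C4 Q"
    "uedges Q = {{u, v}, {v, z}, {z, w}, {w, u}}"
proof
  let ?V = "{u, v, z, w}"
  let ?Q = "\<lparr>pverts = ?V, parcs = {e \<in> parcs G. fst e \<in> ?V \<and> snd e \<in> ?V}\<rparr>"
  have "?V \<subseteq> pverts G" using assms parc_pverts by blast
  have "wf_digraph (with_proj ?Q)" by unfold_locales auto
  then show "induced_subgraph (with_proj ?Q) (with_proj G)"
    using \<open>?V \<subseteq> pverts G\<close> wf_digraph_axioms
    by (auto simp: induced_subgraph_def subgraph_def compatible_def)
  have par: "(x, y) \<in> parcs ?Q \<longleftrightarrow> {x, y} \<in> {{u, v}, {v, z}, {z, w}, {w, u}}" for x y
  proof
    assume "(x, y) \<in> parcs ?Q"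
    then have "x \<in> ?V" "y \<in> ?V" "(x, y) \<in> parcs G" by auto
    moreover have "(z, u) \<notin> parcs G" "(w, v) \<notin> parcs G" using assms parc_sym by blast+
    ultimately show "{x, y} \<in> {{u, v}, {v, z}, {z, w}, {w, u}}"
      using assms parc_irrefl by auto
  next
    assume "{x, y} \<in> {{u, v}, {v, z}, {z, w}, {w, u}}"
    then show "(x, y) \<in> parcs ?Q"
      using assms(2-5) assms(2-5)[THEN parc_sym] by (auto simp: doubleton_eq_iff)
  qed
  show Q: "uedges ?Q = {{u, v}, {v, z}, {z, w}, {w, u}}"
    (is "_ = ?E")
  proof (intro equalityI subsetI)
    fix e assume e: "e \<in> ?E"
    then obtain x y where "e = {x, y}" by blast
    then show "e \<in> uedges ?Q" using e par[of x y] unfolding uedges_def by blast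
  next
    fix e assume "e \<in> uedges ?Q"
    then obtain x y where "e = {x, y}" "(x, y) \<in> parcs ?Q" unfolding uedges_def by blast
    then show "e \<in> ?E" using par[of x y] by simp
  qed
  show "is_C4 ?Q"
    unfolding is_C4_def Q using assms(1) by (intro exI[of _ u] exI[of _ v] exI[of _ z] exI[of _ w]) simp
qed

lemma card_block_mis_le_C4_matching_number:
  assumes "matching G M"
  shows "real (card (block_mis G M)) \<le> (3 / 2) ^ C4_matching_number G * real (mis G)"
  using finite_matching[OF assms] assms
proof (induction M rule: finite_psubset_induct)
  case (psubset M)
  show ?case
  proof (cases "C4_private_matching G M")
    case True
    have "card M \<le> C4_matching_number G"
      unfolding C4_matching_number_def
      using True finite_C4_private_matchings[OF pair_graph_axioms] by (intro Max_ge) auto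
    then have "(3 / 2 :: real) ^ card M \<le> (3 / 2) ^ C4_matching_number G" by (intro power_increasing) auto
    with card_block_mis_matching[OF psubset.prems] show ?thesis
      by (meson mult_right_mono of_nat_0_le_iff order_trans)
  next
    case False
    then obtain e where e: "e \<in> M"
      and no_Q: "\<And>Q. induced_subgraph (with_proj Q) (with_proj G) \<Longrightarrow> is_C4 Q \<Longrightarrow> uedges Q \<inter> M \<noteq> {e}"
      using psubset.prems by (auto simp: C4_private_matching_def)
    obtain u v where uv: "e = {u, v}" "(u, v) \<in> parcs G" "{u, v} \<inter> \<Union>(M - {e}) = {}"
      using matching_edgeE[OF psubset.prems e] .
    have "card (block_mis G (insert {u, v} (M - {e}))) \<le> card (block_mis G (M - {e}))"
    proof (rule card_block_mis_remove_edge_no_C4[OF uv(2,3)], rule ccontr)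
      fix z w
      assume zw: "(v, z) \<in> parcs G" "(z, w) \<in> parcs G" "(w, u) \<in> parcs G" "(u, z) \<notin> parcs G" "(v, w) \<notin> parcs G"
        and zu: "z \<noteq> u" "w \<noteq> v"
        and "\<not> (z \<in> \<Union>(M - {e}) \<or> w \<in> \<Union>(M - {e}))"
      \<comment> \<open>Every side of the cycle other than \<open>e\<close> ends in \<open>z\<close>
        or \<open>w\<close>, which no other edge of \<open>M\<close> covers. Thus the cycle would
        meet \<open>M\<close> in \<open>e\<close> alone.\<close>
      then have notM: "f \<notin> M - {e}" if "z \<in> f \<or> w \<in> f" for f using that by blast
      have dist: "distinct [u, v, z, w]" using zw uv(2) zu parc_irrefl by auto
      obtain Q where Q: "induced_subgraph (with_proj Q) (with_proj G)" "is_C4 Q"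
        and ue: "uedges Q = {{u, v}, {v, z}, {z, w}, {w, u}}"
        using induced_C4[OF dist uv(2) zw] .
      have "{v, z} \<noteq> e" "{z, w} \<noteq> e" "{w, u} \<noteq> e" using dist uv(1) by (auto simp: doubleton_eq_iff)
      then have "{v, z} \<notin> M" "{z, w} \<notin> M" "{w, u} \<notin> M"
        using notM[of "{v, z}"] notM[of "{z, w}"] notM[of "{w, u}"] by auto
      then have "uedges Q \<inter> M = {e}" using ue e uv(1) by auto
      with no_Q[OF Q] show False by simp
    qed
    moreover have "insert {u, v} (M - {e}) = M" using e uv by auto
    ultimately have "real (card (block_mis G M)) \<le> real (card (block_mis G (M - {e})))" by simp
    also have "\<dots> \<le> (3 / 2) ^ C4_matching_number G * real (mis G)"
      using psubset.IH[of "M - {e}"] e matching_Diff[OF psubset.prems] by auto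
    finally show ?thesis .
  qed
qed

end

subsection \<open>Contractions with pendant vertices as block families\<close>

definition contraction_map :: "'a set \<Rightarrow> 'a \<Rightarrow> 'a \<Rightarrow> 'a" where
  "contraction_map S c v = (if v \<in> S then c else v)"

lemma pverts_contract: "pverts (contract G S c) = insert c (pverts G - S)"
  by (simp add: contract_def)

lemma parcs_contract:
  "(a, b) \<in> parcs (contract G S c) \<longleftrightarrow> a \<noteq> b \<and>
    (\<exists>u v. (u, v) \<in> parcs G \<and> a = contraction_map S c u \<and> b = contraction_map S c v)"
  by (auto simp: contract_def Let_def contraction_map_def)

definition fibre :: "'a pair_pre_digraph \<Rightarrow> ('a \<Rightarrow> 'b) \<Rightarrow> 'b \<Rightarrow> 'a set" where
  "fibre G \<phi> a = {v \<in> pverts G. \<phi> v = a}"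

definition pendant_at :: "'a pair_pre_digraph \<Rightarrow> 'a \<Rightarrow> 'a \<Rightarrow> bool" where
  "pendant_at H a d \<longleftrightarrow> (\<forall>x. (d, x) \<in> parcs H \<longleftrightarrow> x = a)"

lemma pendant_atD:
  assumes "pair_graph H" "pendant_at H a d"
  shows "(d, x) \<in> parcs H \<longleftrightarrow> x = a" "(x, d) \<in> parcs H \<longleftrightarrow> x = a"
  using assms pair_graph.parc_sym[OF assms(1)] unfolding pendant_at_def by blast+

text \<open>
  \<open>\<phi>\<close> sends a vertex of \<open>G\<close> to the vertex of \<open>H\<close> into which it has been contracted.
  The vertices of \<open>H\<close> outside the image are the added pendant vertices; repeated contraction may attach
  several of them to one vertex.
\<close>

definition contraction_model :: "'a pair_pre_digraph \<Rightarrow> 'a pair_pre_digraph \<Rightarrow> ('a \<Rightarrow> 'a) \<Rightarrow> bool" where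
  "contraction_model G H \<phi> \<longleftrightarrow> \<phi> ` pverts G \<subseteq> pverts H
    \<and> (\<forall>a \<in> \<phi> ` pverts G. connected_in G (fibre G \<phi> a))
    \<and> (\<forall>a \<in> \<phi> ` pverts G. \<forall>b \<in> \<phi> ` pverts G. a \<noteq> b \<longrightarrow>
        ((a, b) \<in> parcs H \<longleftrightarrow> (\<exists>u \<in> fibre G \<phi> a. \<exists>v \<in> fibre G \<phi> b. (u, v) \<in> parcs G)))
    \<and> (\<forall>d \<in> pverts H - \<phi> ` pverts G. \<exists>a \<in> \<phi> ` pverts G. pendant_at H a d \<and> 2 \<le> card (fibre G \<phi> a))
    \<and> (\<forall>a \<in> \<phi> ` pverts G. 2 \<le> card (fibre G \<phi> a) \<longrightarrow>
        (\<exists>d \<in> pverts H - \<phi> ` pverts G. (d, a) \<in> parcs H))"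

lemma contraction_modelD:
  assumes "contraction_model G H \<phi>"
  shows "v \<in> pverts G \<Longrightarrow> \<phi> v \<in> pverts H"
    and "a \<in> \<phi> ` pverts G \<Longrightarrow> connected_in G (fibre G \<phi> a)"
    and "a \<in> \<phi> ` pverts G \<Longrightarrow> b \<in> \<phi> ` pverts G \<Longrightarrow> a \<noteq> b \<Longrightarrow>
        (a, b) \<in> parcs H \<longleftrightarrow> (\<exists>u \<in> fibre G \<phi> a. \<exists>v \<in> fibre G \<phi> b. (u, v) \<in> parcs G)"
    and "d \<in> pverts H \<Longrightarrow> d \<notin> \<phi> ` pverts G \<Longrightarrow>
        \<exists>a \<in> \<phi> ` pverts G. pendant_at H a d \<and> 2 \<le> card (fibre G \<phi> a)"
    and "a \<in> \<phi> ` pverts G \<Longrightarrow> 2 \<le> card (fibre G \<phi> a) \<Longrightarrow>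
        \<exists>d \<in> pverts H - \<phi> ` pverts G. (d, a) \<in> parcs H"
proof -
  show "a \<in> \<phi> ` pverts G \<Longrightarrow> b \<in> \<phi> ` pverts G \<Longrightarrow> a \<noteq> b \<Longrightarrow>
        (a, b) \<in> parcs H \<longleftrightarrow> (\<exists>u \<in> fibre G \<phi> a. \<exists>v \<in> fibre G \<phi> b. (u, v) \<in> parcs G)"
    using assms unfolding contraction_model_def by metis
qed (use assms in \<open>auto simp: contraction_model_def\<close>)

context pair_graph
begin

lemma contraction_model_id: "contraction_model G G (\<lambda>v. v)"
proof -
  have fib: "fibre G (\<lambda>v. v) a = {a}" if "a \<in> pverts G" for a
    using that by (auto simp: fibre_def)
  moreover have "connected_in G {a}" for a
    by (auto simp: connected_in_def)
  ultimately show ?thesis by (simp add: contraction_model_def)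
qed

lemma finite_fibre: "finite (fibre G \<phi> a)"
  by (simp add: fibre_def pverts_finite)

lemma fibre_model_edge:
  assumes "contraction_model G H \<phi>" "(u, v) \<in> parcs G" "\<phi> u \<noteq> \<phi> v"
  shows "(\<phi> u, \<phi> v) \<in> parcs H"
  using contraction_modelD(3)[OF assms(1), of "\<phi> u" "\<phi> v"] assms(2,3) parc_pverts[OF assms(2)]
  by (auto simp: fibre_def)

lemma fibre_model_edgeE:
  assumes "contraction_model G H \<phi>" "pair_graph H" "(a, b) \<in> parcs H"
    and "a \<in> \<phi> ` pverts G" "b \<in> \<phi> ` pverts G"
  obtains u v where "u \<in> pverts G" "v \<in> pverts G" "(u, v) \<in> parcs G" "\<phi> u = a" "\<phi> v = b"
proof -
  have "a \<noteq> b" using assms(2,3) pair_graph.parc_irrefl by fastforce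
  then show ?thesis
    using contraction_modelD(3)[OF assms(1,4,5)] assms(3) that by (auto simp: fibre_def)
qed

lemma two_le_card_fibre:
  assumes "u \<in> fibre G \<phi> a" "v \<in> fibre G \<phi> a" "u \<noteq> v"
  shows "2 \<le> card (fibre G \<phi> a)"
  using card_mono[OF finite_fibre, of "{u, v}" \<phi> a] assms by simp

text \<open>Preimages under \<open>\<phi>\<close> contain each fibre entirely or not at all. Taking
  preimages is injective here: a pendant belongs to a maximal independent set exactly when its
  neighbour does not, so such a set is determined by its part in the image of
  \<open>\<phi>\<close>.\<close>

lemma mis_contraction_model:
  assumes H: "pair_graph H" and m: "contraction_model G H \<phi>"
  shows "mis H \<le> card (block_mis G {fibre G \<phi> a |a. 2 \<le> card (fibre G \<phi> a)})"
proof -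
  interpret H: pair_graph H by (rule H)
  let ?K = "\<phi> ` pverts G" and ?\<B> = "{fibre G \<phi> a |a. 2 \<le> card (fibre G \<phi> a)}"
  define h where "h I = {v \<in> pverts G. \<phi> v \<in> I}" for I
  note D = block_misD[where \<B> = "{}" and G = H]
  have "h I \<in> block_mis G ?\<B>" if I: "I \<in> block_mis H {}" for I
  proof -
    have "block_independent G ?\<B> (h I)"
    proof (rule block_independentI)
      fix u v assume uv: "u \<in> h I" "v \<in> h I" "(u, v) \<in> parcs G"
      have "(\<phi> u, \<phi> v) \<notin> parcs H" using D(2)[OF I, of "\<phi> u" "\<phi> v"] uv by (auto simp: h_def)
      then have "\<phi> u = \<phi> v" using fibre_model_edge[OF m uv(3)] by blast
      then have fib: "u \<in> fibre G \<phi> (\<phi> u)" "v \<in> fibre G \<phi> (\<phi> u)"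
        using uv by (auto simp: fibre_def h_def)
      moreover have "u \<noteq> v" using uv(3) parc_irrefl by blast
      ultimately have "2 \<le> card (fibre G \<phi> (\<phi> u))" by (rule two_le_card_fibre)
      with fib show "\<exists>B\<in>?\<B>. u \<in> B \<and> v \<in> B" by blast
    qed (auto simp: h_def fibre_def)
    \<comment> \<open>Outside the blocks the fibre of \<open>\<phi> w\<close> is \<open>{w}\<close>,
      so no pendant hangs at \<open>\<phi> w\<close>, and its neighbour \<open>x\<close> in
      \<open>I\<close> is the image of a vertex of \<open>G\<close> adjacent to
      \<open>w\<close>.\<close>
    moreover have False if w: "w \<in> undominated G ?\<B> (h I)" for w
    proof -
      have w': "w \<in> pverts G" "\<phi> w \<notin> I" "w \<notin> \<Union>?\<B>"
        using w by (auto simp: undominated_def h_def)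
      have fib: "w \<in> fibre G \<phi> (\<phi> w)" using w' by (simp add: fibre_def)
      have small: "\<not> 2 \<le> card (fibre G \<phi> (\<phi> w))" using w'(3) fib by blast
      obtain x where x: "x \<in> I" "(x, \<phi> w) \<in> parcs H"
        using D(4)[OF I contraction_modelD(1)[OF m w'(1)] w'(2)] by blast
      have xH: "x \<in> pverts H" using x(2) H.parc_pverts by blast
      have "x \<in> ?K"
      proof (rule ccontr)
        assume "x \<notin> ?K"
        then obtain a where "pendant_at H a x" "2 \<le> card (fibre G \<phi> a)"
          using contraction_modelD(4)[OF m xH] by blast
        with x(2) small show False using pendant_atD(1)[OF H, of a x "\<phi> w"] by simp
      qed
      moreover have "\<phi> w \<in> ?K" using w' by simp
      ultimately obtain u v where uv: "u \<in> pverts G" "v \<in> pverts G" "(u, v) \<in> parcs G" "\<phi> u = x" "\<phi> v = \<phi> w"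
        by (rule fibre_model_edgeE[OF m H x(2)])
      have "v = w"
        using two_le_card_fibre[of v \<phi> "\<phi> w" w] fib small uv by (auto simp: fibre_def)
      then show False using w uv x(1) by (auto simp: undominated_def h_def)
    qed
    ultimately show ?thesis by (auto simp: block_mis_def)
  qed
  moreover have "inj_on h (block_mis H {})"
  proof (rule inj_onI)
    fix I J assume I: "I \<in> block_mis H {}" and J: "J \<in> block_mis H {}" and eq: "h I = h J"
    have K: "x \<in> I \<longleftrightarrow> x \<in> J" if "x \<in> ?K" for x
      using that eq by (auto simp: h_def)
    have char: "d \<in> L \<longleftrightarrow> a \<notin> L" if "L \<in> block_mis H {}" "pendant_at H a d" "d \<in> pverts H" for d a L
      using D(2)[OF that(1), of d a] D(4)[OF that(1,3)] by (auto simp: pendant_atD[OF H that(2)])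
    show "I = J"
    proof (rule set_eqI)
      fix x
      show "x \<in> I \<longleftrightarrow> x \<in> J"
      proof (cases "x \<in> pverts H \<and> x \<notin> ?K")
        case True
        then obtain a where "a \<in> ?K" "pendant_at H a x"
          using contraction_modelD(4)[OF m] by blast
        then show ?thesis using char[OF I] char[OF J] K True by blast
      next
        case False
        then show ?thesis using K D(1)[OF I] D(1)[OF J] by blast
      qed
    qed
  qed
  ultimately have "card (block_mis H {}) \<le> card (block_mis G ?\<B>)"
    using card_inj_on_le[of h "block_mis H {}"] finite_block_mis by blast
  then show ?thesis by (simp add: H.mis_eq_card_block_mis)
qed

lemma mis_contraction_model_bound:
  assumes H: "pair_graph H" and m: "contraction_model G H \<phi>"
  shows "real (mis H) \<le> (3 / 2) ^ C4_matching_number G * real (mis G)"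
proof -
  let ?\<B> = "{fibre G \<phi> a |a. 2 \<le> card (fibre G \<phi> a)}"
  have "?\<B> \<subseteq> Pow (pverts G)" by (auto simp: fibre_def)
  then have "finite ?\<B>" by (rule finite_subset) (simp add: pverts_finite)
  moreover have "finite S \<and> connected_in G S \<and> 2 \<le> card S" if S: "S \<in> ?\<B>" for S
  proof -
    obtain a where a: "S = fibre G \<phi> a" "2 \<le> card S" using S by blast
    then have "S \<noteq> {}" by auto
    then have "a \<in> \<phi> ` pverts G" using a(1) by (auto simp: fibre_def)
    then show ?thesis using a contraction_modelD(2)[OF m] finite_fibre by simp
  qed
  moreover have "S \<inter> S' = {}" if "S \<in> ?\<B>" "S' \<in> ?\<B>" "S \<noteq> S'" for S S'
    using that by (auto simp: fibre_def)
  moreover have "matching G {}" by (simp add: matching_def)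
  moreover have "\<Union>?\<B> \<inter> \<Union>{} = {}" by simp
  ultimately have "\<exists>M. matching G M \<and> card (block_mis G (?\<B> \<union> {})) \<le> card (block_mis G M)"
    by (rule card_block_mis_le_matching)
  then obtain M where M: "matching G M" "card (block_mis G ?\<B>) \<le> card (block_mis G M)" by auto
  have "real (mis H) \<le> real (card (block_mis G M))"
    using mis_contraction_model[OF assms] M(2) by linarith
  also have "\<dots> \<le> (3 / 2) ^ C4_matching_number G * real (mis G)"
    by (rule card_block_mis_le_C4_matching_number[OF M(1)])
  finally show ?thesis .
qed

end

section \<open>Pendant vertices under a further contraction\<close>

lemma pverts_add_pendant: "pverts (add_pendant G c c') = insert c' (pverts G)"
  and parcs_add_pendant: "e \<in> parcs (add_pendant G c c') \<longleftrightarrow> e \<in> parcs G \<or> e = (c, c') \<or> e = (c', c)"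
  by (auto simp: add_pendant_def)

lemma contraction_map_simps [simp]:
  "v \<in> S \<Longrightarrow> contraction_map S c v = c"
  "v \<notin> S \<Longrightarrow> contraction_map S c v = v"
  by (auto simp: contraction_map_def)

text \<open>The name \<open>c'\<close> may be taken from \<open>S\<close>. No arc of the contracted
  graph uses it, because the vertices of \<open>S\<close> are renamed to \<open>c\<close> and
  \<open>c'\<close> is none of the others.\<close>

lemma pendant_at_new_pendant:
  assumes H: "pair_graph H" and c': "c' \<notin> pverts H - S" "c \<noteq> c'"
  shows "pendant_at (add_pendant (contract H S c) c c') c c'"
proof -
  have "(c', x) \<notin> parcs (contract H S c)" for x
  proof
    assume "(c', x) \<in> parcs (contract H S c)"
    then obtain u v where "(u, v) \<in> parcs H" "c' = contraction_map S c u"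
      unfolding parcs_contract by blast
    then show False
      using c' pair_graph.parc_pverts[OF H, of u v] by (auto simp: contraction_map_def split: if_splits)
  qed
  then show ?thesis using c'(2) by (auto simp: pendant_at_def parcs_add_pendant)
qed

text \<open>The vertex \<open>d\<close> keeps its name and no other vertex is sent to it, so its
  single neighbour is merely renamed along with \<open>a\<close>.\<close>

lemma pendant_at_old_pendant:
  assumes H: "pair_graph H" and d: "pendant_at H a d" "d \<in> pverts H - S"
    and c: "c \<notin> pverts H - S" "c' \<notin> pverts H - S"
  shows "pendant_at (add_pendant (contract H S c) c c') (contraction_map S c a) d"
proof -
  have da: "(d, a) \<in> parcs H" using d(1) by (simp add: pendant_at_def)
  then have "d \<noteq> a" "a \<in> pverts H" using pair_graph.parc_irrefl[OF H] pair_graph.parc_pverts[OF H] by blast+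
  have ne: "d \<noteq> c" "d \<noteq> c'" using d(2) c by blast+
  have eq: "u = d" if "contraction_map S c u = d" for u
    using that ne d(2) by (auto simp: contraction_map_def split: if_splits)
  have "(d, x) \<in> parcs (contract H S c) \<longleftrightarrow> x = contraction_map S c a" for x
  proof
    assume "(d, x) \<in> parcs (contract H S c)"
    then obtain u v where uv: "(u, v) \<in> parcs H" "d = contraction_map S c u" "x = contraction_map S c v"
      unfolding parcs_contract by blast
    then have "u = d" using eq by metis
    then have "v = a" using uv(1) d(1) by (simp add: pendant_at_def)
    then show "x = contraction_map S c a" using uv by simp
  next
    assume x: "x = contraction_map S c a"
    have "contraction_map S c d = d" using d(2) by simp
    moreover have "d \<noteq> x" using x eq \<open>d \<noteq> a\<close> by metis
    ultimately show "(d, x) \<in> parcs (contract H S c)"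
      unfolding parcs_contract using da x by metis
  qed
  then show ?thesis using ne by (auto simp: pendant_at_def parcs_add_pendant)
qed

context pair_graph
begin

text \<open>The fibre over \<open>c\<close> becomes the union of the fibres over \<open>S\<close>;
  fibres over images outside \<open>S\<close> stay. The delicate point is that \<open>S\<close> may
  contain pendants of earlier steps, which come from no vertex of \<open>G\<close> and vanish in the
  contraction.\<close>

lemma contraction_model_pendant_step:
  assumes H: "pair_graph H" and m: "contraction_model G H \<phi>"
    and S: "S \<subseteq> pverts H" "connected_in H S" "2 \<le> card S"
    and c: "c \<notin> pverts H - S" "c' \<notin> pverts H - S" "c \<noteq> c'"
  shows "contraction_model G (add_pendant (contract H S c) c c') (contraction_map S c \<circ> \<phi>)"
proof -
  interpret H: pair_graph H by (rule H)
  let ?K = "\<phi> ` pverts G" and ?f = "contraction_map S c"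
  let ?H = "add_pendant (contract H S c) c c'" 
  define \<phi>' where "\<phi>' = contraction_map S c \<circ> \<phi>"
  have \<phi>' [simp]: "\<phi>' v = ?f (\<phi> v)" for v by (simp add: \<phi>'_def)
  have K: "?K \<subseteq> pverts H" using contraction_modelD(1)[OF m] by blast
  \<comment> \<open>As \<open>S\<close> is connected with at least two vertices, it contains the
    only neighbour of each pendant in it.\<close>
  have pend_nbr: "y \<in> S" if x: "x \<in> S" "x \<notin> ?K" "(x, y) \<in> parcs H" for x y
  proof -
    have "{x} \<noteq> S" using S(3) by auto
    then obtain b where "b \<in> S" "(x, b) \<in> parcs H"
      using connected_inD[OF S(2), of "{x}"] x(1) by blast
    moreover obtain a where "pendant_at H a x"
      using contraction_modelD(4)[OF m _ x(2)] x(1) S(1) by blast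
    ultimately show ?thesis using x(3) by (simp add: pendant_at_def)
  qed
  have fib_eq: "fibre G \<phi>' a = fibre G \<phi> a" if "a \<in> ?K" "a \<notin> S" for a
    using that c(1) K by (auto simp: fibre_def contraction_map_def split: if_splits)
  have fib_c: "fibre G \<phi>' c = {v \<in> pverts G. \<phi> v \<in> S}"
    using c(1) K by (auto simp: fibre_def contraction_map_def split: if_splits)
  have fib_sub: "fibre G \<phi> a \<subseteq> fibre G \<phi>' (?f a)" for a
    by (auto simp: fibre_def)
  have card_fib_sub: "2 \<le> card (fibre G \<phi>' (?f a))" if "2 \<le> card (fibre G \<phi> a)" for a
    using that card_mono[OF finite_fibre fib_sub] by (meson order_trans)
  obtain s t where st: "s \<in> S" "t \<in> S" "s \<noteq> t"
  proof -
    obtain s where "s \<in> S" using S(3) by fastforce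
    moreover have "{s} \<noteq> S" using S(3) by force
    ultimately show ?thesis using that by blast
  qed
  have pend_S: "2 \<le> card (fibre G \<phi>' c) \<and> c \<in> \<phi>' ` pverts G" if x: "x \<in> S" "x \<notin> ?K" for x
  proof -
    obtain a where a: "a \<in> ?K" "pendant_at H a x" "2 \<le> card (fibre G \<phi> a)"
      using contraction_modelD(4)[OF m _ x(2)] x(1) S(1) by blast
    have "a \<in> S" using pend_nbr[OF x] a(2) by (simp add: pendant_at_def)
    then have "?f a = c" by simp
    moreover have "?f a \<in> \<phi>' ` pverts G" using a(1) by (metis \<phi>' imageE imageI)
    ultimately show ?thesis using card_fib_sub[OF a(3)] by simp
  qed
  \<comment> \<open>Two vertices of \<open>S\<close> need not stand for two vertices of
    \<open>G\<close>, as one may be a pendant. Then the vertex it hangs at lies in \<open>S\<close>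
    too, and its fibre already has two elements.\<close>
  have c_props: "2 \<le> card (fibre G \<phi>' c) \<and> c \<in> \<phi>' ` pverts G"
  proof (cases "s \<in> ?K \<and> t \<in> ?K")
    case True
    then obtain u v where uv: "u \<in> pverts G" "\<phi> u = s" "v \<in> pverts G" "\<phi> v = t" by blast
    then have "u \<in> fibre G \<phi>' c" "v \<in> fibre G \<phi>' c" "u \<noteq> v" using st by (auto simp: fib_c)
    then have "2 \<le> card (fibre G \<phi>' c)" by (rule two_le_card_fibre)
    moreover have "\<phi>' u = c" using uv(2) st(1) by simp
    then have "c \<in> \<phi>' ` pverts G" using uv(1) by (metis imageI)
    ultimately show ?thesis by (rule conjI)
  next
    case False
    then show ?thesis using pend_S[OF st(1)] pend_S[OF st(2)] by argo
  qed
  note c_card = c_props[THEN conjunct1] and c_K = c_props[THEN conjunct2]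
  have K2: "\<phi>' ` pverts G = insert c (?K - S)"
  proof
    show "\<phi>' ` pverts G \<subseteq> insert c (?K - S)" by (auto simp: contraction_map_def)
    have "a \<in> \<phi>' ` pverts G" if a: "a \<in> ?K" "a \<notin> S" for a
    proof -
      obtain v where "v \<in> pverts G" "\<phi> v = a" using a by blast
      moreover from this have "\<phi>' v = a" using a by simp
      ultimately show ?thesis by (metis imageI)
    qed
    with c_K show "insert c (?K - S) \<subseteq> \<phi>' ` pverts G" by blast
  qed
  have conn_c: "connected_in G (fibre G \<phi>' c)"
    unfolding connected_in_def
  proof (intro allI impI)
    fix T assume T: "T \<subseteq> fibre G \<phi>' c \<and> T \<noteq> {} \<and> T \<noteq> fibre G \<phi>' c"
    then have TG: "T \<subseteq> pverts G" "\<And>v. v \<in> T \<Longrightarrow> \<phi> v \<in> S" by (auto simp: fib_c)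
    show "\<exists>u\<in>T. \<exists>v\<in>fibre G \<phi>' c - T. (u, v) \<in> parcs G"
    \<comment> \<open>Either \<open>T\<close> cuts through a fibre of \<open>\<phi>\<close>, whose
      connectivity yields the arc, or \<open>T\<close> is a union of fibres and the cut can be moved
      to \<open>S\<close> in \<open>H\<close>.\<close>
    proof (cases "\<exists>u\<in>T. \<exists>v\<in>pverts G - T. \<phi> u = \<phi> v")
      case True
      then obtain u v where uv: "u \<in> T" "v \<in> pverts G" "v \<notin> T" "\<phi> u = \<phi> v" by blast
      have "connected_in G (fibre G \<phi> (\<phi> u))" using contraction_modelD(2)[OF m] uv TG by blast
      moreover have "T \<inter> fibre G \<phi> (\<phi> u) \<noteq> {}" using uv TG by (auto simp: fibre_def)
      moreover have "T \<inter> fibre G \<phi> (\<phi> u) \<noteq> fibre G \<phi> (\<phi> u)" using uv by (auto simp: fibre_def)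
      ultimately obtain a b where ab: "a \<in> T \<inter> fibre G \<phi> (\<phi> u)" "b \<in> fibre G \<phi> (\<phi> u)"
        "b \<notin> T \<inter> fibre G \<phi> (\<phi> u)" "(a, b) \<in> parcs G"
        using connected_inD[of G "fibre G \<phi> (\<phi> u)" "T \<inter> fibre G \<phi> (\<phi> u)"] by blast
      have "b \<in> pverts G" "\<phi> b \<in> S" using ab(2) TG(2)[OF uv(1)] by (simp_all add: fibre_def)
      then have "b \<in> fibre G \<phi>' c - T" using ab by (simp add: fib_c fibre_def)
      moreover have "a \<in> T" using ab(1) by simp
      ultimately show ?thesis using ab(4) by (intro bexI)
    next
      case False
      have union: "v \<in> T" if v: "v \<in> pverts G" "\<phi> v \<in> \<phi> ` T" for v
      proof -
        obtain u where "u \<in> T" "\<phi> u = \<phi> v" using v(2) by (metis imageE)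
        then show ?thesis using False v(1) by blast
      qed
      define U where "U = \<phi> ` T"
      have UK: "U \<subseteq> ?K" unfolding U_def by (rule image_mono[OF TG(1)])
      have union: "v \<in> T \<longleftrightarrow> \<phi> v \<in> U" if "v \<in> pverts G" for v
        using union[OF that] unfolding U_def by blast
      \<comment> \<open>Pendants in \<open>S\<close> are put on the side of the vertex they hang at.
        Hence an arc of \<open>H\<close> inside \<open>S\<close> that crosses the cut is no pendant
        arc and lifts to \<open>G\<close>.\<close>
      define T' where "T' = {x \<in> S. x \<in> U \<or> x \<notin> ?K \<and> (\<exists>a\<in>U. (x, a) \<in> parcs H)}"
      obtain v where v: "v \<in> pverts G" "\<phi> v \<in> S" "v \<notin> T" using T by (auto simp: fib_c)
      then have "\<phi> v \<notin> T'" using union by (auto simp: T'_def)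
      then have "T' \<noteq> S" using v by blast
      moreover have "T' \<noteq> {}"
      proof -
        obtain w where "w \<in> T" using T by blast
        then have "\<phi> w \<in> T'" using TG union by (auto simp: T'_def)
        then show ?thesis by blast
      qed
      moreover have "T' \<subseteq> S" by (auto simp: T'_def)
      ultimately obtain x y where xy: "x \<in> T'" "y \<in> S" "y \<notin> T'" "(x, y) \<in> parcs H"
        using connected_inD[OF S(2)] by metis
      have "y \<notin> U" using xy(2,3) unfolding T'_def by blast
      have "x \<in> ?K"
      proof (rule ccontr)
        assume "x \<notin> ?K"
        then have "x \<notin> U" using UK by (metis subsetD)
        then obtain a where a: "a \<in> U" "(x, a) \<in> parcs H" using xy(1) by (auto simp only: T'_def)
        obtain b where "pendant_at H b x"
          using contraction_modelD(4)[OF m _ \<open>x \<notin> ?K\<close>] xy(4) H.parc_pverts by blast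
        then have "a = y" using a xy(4) by (simp add: pendant_at_def)
        then show False using a \<open>y \<notin> U\<close> by simp
      qed
      then have xT: "x \<in> U" using xy(1) by (simp add: T'_def)
      have "y \<in> ?K"
        using xy(2,3) xT H.parc_sym[OF xy(4)] by (simp only: T'_def mem_Collect_eq) metis
      with \<open>x \<in> ?K\<close> obtain u v where uv: "u \<in> pverts G" "v \<in> pverts G" "(u, v) \<in> parcs G" "\<phi> u = x" "\<phi> v = y"
        by (rule fibre_model_edgeE[OF m H xy(4)])
      have "u \<in> T" using union uv xT by simp
      moreover have "v \<notin> T" using union uv \<open>y \<notin> U\<close> by simp
      moreover have "v \<in> fibre G \<phi>' c" using uv xy(2) by (simp add: fib_c)
      ultimately show ?thesis using uv(3) by blast
    qed
  qed
  have c'K: "c' \<notin> \<phi>' ` pverts G" unfolding K2 using c(2,3) subsetD[OF K] by blast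
  have edges: "(a, b) \<in> parcs ?H \<longleftrightarrow> (\<exists>u \<in> fibre G \<phi>' a. \<exists>v \<in> fibre G \<phi>' b. (u, v) \<in> parcs G)"
    if ab: "a \<in> \<phi>' ` pverts G" "b \<in> \<phi>' ` pverts G" "a \<noteq> b" for a b
  proof
    assume "(a, b) \<in> parcs ?H"
    then have "(a, b) \<in> parcs (contract H S c)"
      using ab c'K unfolding parcs_add_pendant by blast
    then obtain x y where xy: "(x, y) \<in> parcs H" "a = ?f x" "b = ?f y"
      unfolding parcs_contract by blast
    \<comment> \<open>Old pendants contribute no arcs between images: a pendant in \<open>S\<close>
      has its neighbour in \<open>S\<close>, so its arc becomes a loop, and a pendant outside
      \<open>S\<close> is not in the image of \<open>\<phi>'\<close>.\<close>
    have in_K: "x \<in> ?K" if xy: "(x, y) \<in> parcs H" "?f x \<in> \<phi>' ` pverts G" "?f x \<noteq> ?f y" for x y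
    proof (rule ccontr)
      assume x: "x \<notin> ?K"
      have "x \<in> S"
      proof (rule ccontr)
        assume "x \<notin> S"
        then have "x \<in> insert c (?K - S)" using xy(2) K2 by simp
        then show False using x \<open>x \<notin> S\<close> c(1) H.parc_pverts[OF xy(1)] by blast
      qed
      then have "y \<in> S" using pend_nbr x xy(1) by blast
      then show False using xy(3) \<open>x \<in> S\<close> by simp
    qed
    have "x \<in> ?K" by (rule in_K[OF xy(1)]) (use ab xy in auto)
    moreover have "y \<in> ?K" by (rule in_K[OF H.parc_sym[OF xy(1)]]) (use ab xy in auto)
    ultimately obtain u v where uv: "u \<in> pverts G" "v \<in> pverts G" "(u, v) \<in> parcs G" "\<phi> u = x" "\<phi> v = y"
      by (rule fibre_model_edgeE[OF m H xy(1)])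
    then have "u \<in> fibre G \<phi>' a" "v \<in> fibre G \<phi>' b" using xy by (auto simp: fibre_def)
    then show "\<exists>u \<in> fibre G \<phi>' a. \<exists>v \<in> fibre G \<phi>' b. (u, v) \<in> parcs G" using uv(3) by blast
  next
    assume "\<exists>u \<in> fibre G \<phi>' a. \<exists>v \<in> fibre G \<phi>' b. (u, v) \<in> parcs G"
    then obtain u v where uv: "?f (\<phi> u) = a" "?f (\<phi> v) = b" "(u, v) \<in> parcs G"
      by (auto simp: fibre_def)
    then have "\<phi> u \<noteq> \<phi> v" using ab by auto
    then have "(\<phi> u, \<phi> v) \<in> parcs H" using fibre_model_edge[OF m uv(3)] by blast
    then have "(a, b) \<in> parcs (contract H S c)"
      unfolding parcs_contract using uv ab(3) by blast
    then show "(a, b) \<in> parcs ?H" by (simp add: parcs_add_pendant)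
  qed
  have pendants: "\<exists>a \<in> \<phi>' ` pverts G. pendant_at ?H a d \<and> 2 \<le> card (fibre G \<phi>' a)"
    if d: "d \<in> pverts ?H" "d \<notin> \<phi>' ` pverts G" for d
  proof (cases "d = c'")
    case True
    then show ?thesis using pendant_at_new_pendant[OF H c(2,3)] c_card c_K by blast
  next
    case False
    then have d': "d \<in> pverts H - S" "d \<notin> ?K"
      using d K2 by (auto simp: pverts_add_pendant pverts_contract)
    then obtain a where a: "a \<in> ?K" "pendant_at H a d" "2 \<le> card (fibre G \<phi> a)"
      using contraction_modelD(4)[OF m] by blast
    have "?f a \<in> \<phi>' ` pverts G" using a(1) by (metis \<phi>' imageE imageI)
    then show ?thesis
      using pendant_at_old_pendant[OF H a(2) d'(1) c(1,2)] card_fib_sub[OF a(3)] by blast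
  qed
  have has_pendant: "\<exists>d \<in> pverts ?H - \<phi>' ` pverts G. (d, a) \<in> parcs ?H"
    if a: "a \<in> \<phi>' ` pverts G" "2 \<le> card (fibre G \<phi>' a)" for a
  proof (cases "a = c")
    case True
    then show ?thesis using c'K by (auto simp: pverts_add_pendant parcs_add_pendant)
  next
    case False
    then have a': "a \<in> ?K" "a \<notin> S" using a(1) K2 by auto
    then obtain d where d: "d \<in> pverts H" "d \<notin> ?K" "(d, a) \<in> parcs H"
      using contraction_modelD(5)[OF m a'(1)] a(2) fib_eq[OF a'] by auto
    \<comment> \<open>The pendant of \<open>a\<close> survives the contraction, since in
      \<open>S\<close> it would force \<open>a\<close> into \<open>S\<close>.\<close>
    have "d \<notin> S" using pend_nbr d(2,3) a'(2) by blast
    have "d \<noteq> c" using d(1) \<open>d \<notin> S\<close> c(1) by blast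
    have "d \<noteq> a" using d(3) H.parc_irrefl by blast
    then have "(d, a) \<in> parcs (contract H S c)"
      unfolding parcs_contract using d(3) a'(2) \<open>d \<notin> S\<close>
      by (intro conjI exI[of _ d] exI[of _ a]) simp_all
    moreover have "d \<notin> \<phi>' ` pverts G" using K2 d(2) \<open>d \<noteq> c\<close> by blast
    ultimately show ?thesis
      using d(1) \<open>d \<notin> S\<close> by (intro bexI[of _ d]) (auto simp: pverts_add_pendant pverts_contract parcs_add_pendant)
  qed
  have conn: "connected_in G (fibre G \<phi>' a)" if "a \<in> \<phi>' ` pverts G" for a
  proof (cases "a = c")
    case False
    then have "a \<in> ?K" "a \<notin> S" using that K2 by auto
    then show ?thesis using fib_eq contraction_modelD(2)[OF m] by simp
  qed (use conn_c in simp)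
  have img: "\<phi>' ` pverts G \<subseteq> pverts ?H"
    using K K2 by (auto simp: pverts_add_pendant pverts_contract)
  show ?thesis
    unfolding contraction_model_def \<phi>'_def[symmetric]
    by (intro conjI ballI impI)
      (rule img | rule conn, assumption | rule edges; assumption
        | rule pendants, erule DiffD1, rule notI, erule DiffD2, assumption | rule has_pendant; assumption)+
qed

lemma pendant_contractions_model:
  assumes "H \<in> pendant_contractions G"
  shows "\<exists>\<phi>. contraction_model G H \<phi>"
  using assms
proof induction
  case refl
  then show ?case using contraction_model_id by blast
next
  case (step H C c c')
  then obtain \<phi> where "contraction_model G H \<phi>" by blast
  moreover have "pair_graph H" using pendant_contractions_wf[OF pair_graph_axioms step(1)] by blast
  moreover have "pverts C \<subseteq> pverts H" using step by (auto simp: subgraph_def)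
  moreover have "connected_in H (pverts C)" by (rule connected_in_connected_subgraph) fact+
  ultimately show ?case using contraction_model_pendant_step step by blast
qed

end

section \<open>Contractions without pendants, and the middle inequality\<close>

definition pendant_extension :: "'a pair_pre_digraph \<Rightarrow> 'a pair_pre_digraph \<Rightarrow> ('a \<Rightarrow> 'a) \<Rightarrow> bool" where
  "pendant_extension H H' \<psi> \<longleftrightarrow> inj_on \<psi> (pverts H) \<and> \<psi> ` pverts H \<subseteq> pverts H'
    \<and> (\<forall>u\<in>pverts H. \<forall>v\<in>pverts H. (\<psi> u, \<psi> v) \<in> parcs H' \<longleftrightarrow> (u, v) \<in> parcs H)
    \<and> (\<forall>d \<in> pverts H' - \<psi> ` pverts H. \<exists>a \<in> \<psi> ` pverts H. pendant_at H' a d)"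

text \<open>\<open>g\<close> carries \<open>I\<close> over to \<open>H'\<close> and adds each
  pendant whose neighbour is not selected. Pendants hang only at vertices of the copy of
  \<open>H\<close>, so the result is a maximal independent set, and its trace on the copy gives back
  \<open>I\<close>.\<close>

lemma mis_pendant_extension:
  assumes H: "pair_graph H" and H': "pair_graph H'" and ext: "pendant_extension H H' \<psi>"
  shows "mis H \<le> mis H'"
proof -
  interpret H: pair_graph H by (rule H)
  interpret H': pair_graph H' by (rule H')
  have inj: "inj_on \<psi> (pverts H)" and im: "\<psi> ` pverts H \<subseteq> pverts H'"
    and edge: "\<And>u v. u \<in> pverts H \<Longrightarrow> v \<in> pverts H \<Longrightarrow> (\<psi> u, \<psi> v) \<in> parcs H' \<longleftrightarrow> (u, v) \<in> parcs H"
    and pend: "\<And>d. d \<in> pverts H' \<Longrightarrow> d \<notin> \<psi> ` pverts H \<Longrightarrow> \<exists>a \<in> \<psi> ` pverts H. pendant_at H' a d"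
    using ext unfolding pendant_extension_def by blast+
  define P where "P I = {d \<in> pverts H' - \<psi> ` pverts H. \<forall>x\<in>I. (d, \<psi> x) \<notin> parcs H'}" for I
  define g where "g I = \<psi> ` I \<union> P I" for I
  have "g I \<in> block_mis H' {}" if I: "I \<in> block_mis H {}" for I
  proof -
    note D = block_misD[OF I]
    have nbr_P: "y \<in> \<psi> ` pverts H \<and> y \<notin> \<psi> ` I" if "d \<in> P I" "(d, y) \<in> parcs H'" for d y
    proof -
      have d: "d \<in> pverts H'" "d \<notin> \<psi> ` pverts H" "\<forall>x\<in>I. (d, \<psi> x) \<notin> parcs H'"
        using that(1) by (simp_all add: P_def)
      obtain a where "a \<in> \<psi> ` pverts H" "pendant_at H' a d"
        using pend[OF d(1,2)] by (elim bexE)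
      then have "y \<in> \<psi> ` pverts H" using that(2) by (simp add: pendant_at_def)
      moreover have "y \<notin> \<psi> ` I" using d(3) that(2) by (metis imageE)
      ultimately show ?thesis by (rule conjI)
    qed
    have not_gI: "y \<notin> g I" if "d \<in> P I" "(d, y) \<in> parcs H'" for d y
      using nbr_P[OF that] by (simp add: g_def P_def)
    have no: "(x, y) \<notin> parcs H'" if xy: "x \<in> g I" "y \<in> g I" for x y
    proof
      assume e: "(x, y) \<in> parcs H'"
      have "x \<notin> P I" using not_gI[OF _ e] xy(2) by metis
      moreover have "y \<notin> P I" using not_gI[OF _ H'.parc_sym[OF e]] xy(1) by metis
      ultimately obtain u v where uv: "u \<in> I" "v \<in> I" "x = \<psi> u" "y = \<psi> v" using xy by (auto simp: g_def)
      then have "(u, v) \<in> parcs H" using e edge[of u v] D(1) by auto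
      then show False using D(2)[OF uv(1,2)] by simp
    qed
    have "g I \<subseteq> pverts H'" using D(1) im by (auto simp: g_def P_def)
    then have "block_independent H' {} (g I)" using no by (intro block_independentI) auto
    moreover have "\<exists>x\<in>g I. (x, w) \<in> parcs H'" if w: "w \<in> pverts H'" "w \<notin> g I" for w
    proof (cases "w \<in> \<psi> ` pverts H")
      case True
      then obtain v where v: "v \<in> pverts H" "w = \<psi> v" by blast
      then have "v \<notin> I" using w by (auto simp: g_def)
      then obtain x where "x \<in> I" "(x, v) \<in> parcs H" using D(4)[OF v(1)] by auto
      then show ?thesis using edge[of x v] v D(1) by (auto simp: g_def)
    next
      case False
      then obtain x where "x \<in> I" "(w, \<psi> x) \<in> parcs H'" using w by (auto simp: g_def P_def)
      then show ?thesis using H'.parc_sym by (auto simp: g_def)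
    qed
    ultimately show ?thesis by (auto simp: block_mis_def undominated_def)
  qed
  moreover have "inj_on g (block_mis H {})"
  proof (rule inj_onI)
    fix I J assume IJ: "I \<in> block_mis H {}" "J \<in> block_mis H {}" and "g I = g J"
    moreover have "g L \<inter> \<psi> ` pverts H = \<psi> ` L" if "L \<in> block_mis H {}" for L
      using block_misD(1)[OF that] by (auto simp: g_def P_def)
    ultimately have "\<psi> ` I = \<psi> ` J" by metis
    then show "I = J"
      using inj_on_image_eq_iff[OF inj block_misD(1)[OF IJ(1)] block_misD(1)[OF IJ(2)]] by simp
  qed
  ultimately show ?thesis
    unfolding H.mis_eq_card_block_mis H'.mis_eq_card_block_mis
    using card_inj_on_le[of g "block_mis H {}"] H'.finite_block_mis by blast
qed

text \<open>An edge contraction in \<open>H\<close> is imitated by the pendant contraction of the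
  corresponding edge in \<open>H'\<close>. The merged vertex takes the name \<open>\<psi> u\<close>
  and the pendant the name \<open>\<psi> v\<close>, so the vertex set of \<open>H'\<close> does not
  change and no fresh names are needed. The merged vertex \<open>c\<close> of \<open>H\<close> is
  named independently of this, hence the update of \<open>\<psi>\<close>.\<close>

lemma pendant_extension_step:
  assumes H: "pair_graph H" and H': "pair_graph H'" and ext: "pendant_extension H H' \<psi>"
    and uv: "(u, v) \<in> parcs H" and c: "c \<notin> pverts H - {u, v}"
  shows "pendant_extension (contract H {u, v} c)
    (add_pendant (contract H' {\<psi> u, \<psi> v} (\<psi> u)) (\<psi> u) (\<psi> v)) (\<psi>(c := \<psi> u))"
proof -
  interpret H: pair_graph H by (rule H)
  interpret H': pair_graph H' by (rule H')
  let ?H = "contract H {u, v} c" and ?\<psi> = "\<psi>(c := \<psi> u)"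
  let ?C = "contract H' {\<psi> u, \<psi> v} (\<psi> u)"
  let ?H' = "add_pendant ?C (\<psi> u) (\<psi> v)"
  let ?f = "contraction_map {u, v} c" and ?f' = "contraction_map {\<psi> u, \<psi> v} (\<psi> u)"
  have inj: "inj_on \<psi> (pverts H)" and im: "\<psi> ` pverts H \<subseteq> pverts H'"
    and edge: "\<And>u v. u \<in> pverts H \<Longrightarrow> v \<in> pverts H \<Longrightarrow> (\<psi> u, \<psi> v) \<in> parcs H' \<longleftrightarrow> (u, v) \<in> parcs H"
    and pend: "\<And>d. d \<in> pverts H' \<Longrightarrow> d \<notin> \<psi> ` pverts H \<Longrightarrow> \<exists>a \<in> \<psi> ` pverts H. pendant_at H' a d"
    using ext unfolding pendant_extension_def by blast+
  have uvH: "u \<in> pverts H" "v \<in> pverts H" "u \<noteq> v"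
    using H.parc_pverts[OF uv] uv H.parc_irrefl by blast+
  then have \<psi>uv: "\<psi> u \<noteq> \<psi> v" "\<psi> u \<in> pverts H'" "\<psi> v \<in> pverts H'"
    using inj im by (auto simp: inj_on_eq_iff)
  have V: "pverts ?H = insert c (pverts H - {u, v})" by (rule pverts_contract)
  have V': "pverts ?H' = pverts H'"
    using \<psi>uv by (auto simp: pverts_add_pendant pverts_contract)
  have \<psi>_eq: "?\<psi> x = \<psi> x" if "x \<in> pverts H - {u, v}" for x using that c by auto
  have im2: "?\<psi> ` pverts ?H = \<psi> ` pverts H - {\<psi> v}"
  proof -
    have "?\<psi> ` (pverts H - {u, v}) = \<psi> ` (pverts H - {u, v})"
      by (rule image_cong[OF HOL.refl \<psi>_eq])
    also have "\<dots> = \<psi> ` pverts H - {\<psi> u, \<psi> v}"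
      using inj_on_image_set_diff[OF inj, of "pverts H" "{u, v}"] uvH by auto
    finally show ?thesis using \<psi>uv(1) uvH(1) unfolding V by auto
  qed
  have inj2: "inj_on ?\<psi> (pverts ?H)"
  proof -
    have "inj_on ?\<psi> (pverts H - {u, v})"
      using inj_on_diff[OF inj] \<psi>_eq by (simp add: inj_on_def)
    moreover have "?\<psi> c \<notin> ?\<psi> ` (pverts H - {u, v} - {c})"
      using inj uvH by (auto simp: inj_on_eq_iff)
    ultimately show ?thesis unfolding V by (simp add: inj_on_insert)
  qed
  \<comment> \<open>The two contractions commute with the embedding, so arcs can be followed in
    either direction.\<close>
  have comm: "?\<psi> (?f x) = ?f' (\<psi> x)" if "x \<in> pverts H" for x
  proof (cases "x \<in> {u, v}")
    case False
    then have "\<psi> x \<notin> {\<psi> u, \<psi> v}" using that uvH inj by (auto simp: inj_on_eq_iff)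
    then show ?thesis using False that \<psi>_eq by simp
  qed auto
  have f_in: "?f x \<in> pverts ?H" if "x \<in> pverts H" for x
    using that by (auto simp: V contraction_map_def)
  have edge2: "(?\<psi> a, ?\<psi> b) \<in> parcs ?H' \<longleftrightarrow> (a, b) \<in> parcs ?H" if ab: "a \<in> pverts ?H" "b \<in> pverts ?H" for a b
  proof
    assume e: "(?\<psi> a, ?\<psi> b) \<in> parcs ?H'"
    have ab_im: "?\<psi> a \<in> \<psi> ` pverts H - {\<psi> v}" "?\<psi> b \<in> \<psi> ` pverts H - {\<psi> v}"
      using ab im2 by blast+
    then have "(?\<psi> a, ?\<psi> b) \<in> parcs ?C" using e unfolding parcs_add_pendant by blast
    then obtain x' y' where xy': "(x', y') \<in> parcs H'" "?\<psi> a = ?f' x'" "?\<psi> b = ?f' y'" and ne: "?\<psi> a \<noteq> ?\<psi> b"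
      unfolding parcs_contract by blast
    \<comment> \<open>Only vertices of the copy of \<open>H\<close> are merged, so the pendants of
      \<open>H'\<close> yield no arcs between vertices of the copy.\<close>
    have in_im: "x' \<in> \<psi> ` pverts H" if "?f' x' \<in> \<psi> ` pverts H" for x'
      using that uvH by (auto simp: contraction_map_def split: if_splits)
    obtain x y where xy: "x \<in> pverts H" "x' = \<psi> x" "y \<in> pverts H" "y' = \<psi> y"
      using in_im[of x'] in_im[of y'] xy' ab_im by auto
    then have "(x, y) \<in> parcs H" using xy'(1) edge by simp
    moreover have "a = ?f x" "b = ?f y"
      using xy'(2,3) xy comm f_in ab inj_onD[OF inj2] by metis+
    moreover have "a \<noteq> b" using ne by blast
    ultimately show "(a, b) \<in> parcs ?H" unfolding parcs_contract by blast
  next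
    assume "(a, b) \<in> parcs ?H"
    then obtain x y where xy: "(x, y) \<in> parcs H" "a = ?f x" "b = ?f y" "a \<noteq> b"
      unfolding parcs_contract by blast
    have xyH: "x \<in> pverts H" "y \<in> pverts H" using H.parc_pverts[OF xy(1)] by blast+
    then have "(\<psi> x, \<psi> y) \<in> parcs H'" using edge xy(1) by blast
    moreover have "?\<psi> a = ?f' (\<psi> x)" "?\<psi> b = ?f' (\<psi> y)" using comm xyH xy by blast+
    moreover have "?\<psi> a \<noteq> ?\<psi> b" using inj_onD[OF inj2 _ ab] xy(4) by blast
    ultimately show "(?\<psi> a, ?\<psi> b) \<in> parcs ?H'" unfolding parcs_add_pendant parcs_contract by blast
  qed
  have pend2: "\<exists>a \<in> ?\<psi> ` pverts ?H. pendant_at ?H' a d" if d: "d \<in> pverts ?H'" "d \<notin> ?\<psi> ` pverts ?H" for d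
  proof (cases "d = \<psi> v")
    case True
    have "pendant_at ?H' (\<psi> u) (\<psi> v)" by (rule pendant_at_new_pendant[OF H']) (use \<psi>uv in auto)
    moreover have "\<psi> u \<in> ?\<psi> ` pverts ?H" using im2 uvH \<psi>uv(1) by auto
    ultimately show ?thesis using True by blast
  next
    case False
    then have d': "d \<in> pverts H'" "d \<notin> \<psi> ` pverts H" using d V' im2 by auto
    then obtain a where a: "a \<in> \<psi> ` pverts H" "pendant_at H' a d" using pend by blast
    have "d \<in> pverts H' - {\<psi> u, \<psi> v}" using d' uvH by blast
    then have "pendant_at ?H' (?f' a) d" using pendant_at_old_pendant[OF H' a(2)] by simp
    moreover have "?f' a \<in> ?\<psi> ` pverts ?H"
      using a(1) comm f_in by (metis (no_types, lifting) imageE imageI)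
    ultimately show ?thesis by blast
  qed
  have "?\<psi> ` pverts ?H \<subseteq> pverts ?H'" using im2 im V' by blast
  then show ?thesis unfolding pendant_extension_def using inj2 edge2 pend2 by blast
qed

text \<open>The subgraph \<open>C\<close> is the edge alone. Contracting it frees both names, so
  \<open>u\<close> can be the merged vertex and \<open>v\<close> its pendant.\<close>

lemma edge_in_pendant_contractions:
  assumes H: "H \<in> pendant_contractions G" "pair_graph H" and uv: "(u, v) \<in> parcs H"
  shows "add_pendant (contract H {u, v} u) u v \<in> pendant_contractions G"
proof -
  let ?C = "\<lparr>pverts = {u, v}, parcs = {(u, v), (v, u)}\<rparr>"
  interpret H: pair_graph H by (rule H(2))
  have uvH: "u \<in> pverts H" "v \<in> pverts H" "u \<noteq> v" "(v, u) \<in> parcs H"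
    using H.parc_pverts[OF uv] uv H.parc_irrefl H.parc_sym by blast+
  have C: "pair_graph ?C" using uvH by (auto simp: pair_graph_iff sym_def irrefl_def)
  then interpret C: pair_graph ?C .
  have "subgraph (with_proj ?C) (with_proj H)"
    using uvH uv C.wf_digraph_axioms H.wf_digraph_axioms
    by (auto simp: subgraph_def compatible_def)
  moreover have "Digraph_Component.connected (with_proj ?C)"
  proof -
    let ?R = "rtrancl_on {u, v} (parcs (mk_symmetric (with_proj ?C)))"
    have "(u, v) \<in> parcs (mk_symmetric (with_proj ?C))" "(v, u) \<in> parcs (mk_symmetric (with_proj ?C))"
      by (auto simp: parcs_mk_symmetric)
    then have "(a, b) \<in> ?R" if "a \<in> {u, v}" "b \<in> {u, v}" for a b
      using that by (auto intro: rtrancl_on_into_rtrancl_on)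
    then show ?thesis
      unfolding Digraph_Component.connected_def strongly_connected_def reachable_def by simp
  qed
  moreover have "2 \<le> card (pverts ?C)" using uvH by simp
  ultimately have "add_pendant (contract H (pverts ?C) u) u v \<in> pendant_contractions G"
    using C uvH(3) H(1) by (intro pendant_contractions.step) auto
  then show ?thesis by simp
qed

lemma edge_contractions_pendant_extension:
  assumes G: "pair_graph G" and "H \<in> edge_contractions G"
  shows "\<exists>H' \<psi>. H' \<in> pendant_contractions G \<and> pendant_extension H H' \<psi>"
  using assms(2)
proof induction
  case refl
  have "pendant_extension G G (\<lambda>v. v)" by (simp add: pendant_extension_def)
  then show ?case using pendant_contractions.refl by blast
next
  case (step H u v c)
  then obtain H' \<psi> where H': "H' \<in> pendant_contractions G" and ext: "pendant_extension H H' \<psi>" by blast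
  have pg: "pair_graph H" "pair_graph H'"
    using edge_contractions_wf[OF G step(1)] pendant_contractions_wf[OF G H'] by auto
  have "(\<psi> u, \<psi> v) \<in> parcs H'"
    using ext step(2) pair_graph.parc_pverts[OF pg(1) step(2)] by (simp add: pendant_extension_def)
  from edge_in_pendant_contractions[OF H' pg(2) this] pendant_extension_step[OF pg ext step(2,3)]
  show ?case by blast
qed

theorem corollary2:
  fixes G :: "'a pair_pre_digraph"
  assumes "pair_graph G"
  shows "mis G \<le> Max (mis ` edge_contractions G)
    \<and> Max (mis ` edge_contractions G) \<le> Max (mis ` pendant_contractions G)
    \<and> real (Max (mis ` pendant_contractions G)) \<le> (3 / 2) ^ C4_matching_number G * real (mis G)"
proof (intro conjI)
  note finE = finite_mis_edge_contractions[OF assms] and finP = finite_mis_pendant_contractions[OF assms]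
  show "mis G \<le> Max (mis ` edge_contractions G)"
    using finE edge_contractions.refl by (intro Max_ge) auto
  have "mis H \<le> Max (mis ` pendant_contractions G)" if H: "H \<in> edge_contractions G" for H
  proof -
    obtain H' \<psi> where H': "H' \<in> pendant_contractions G" "pendant_extension H H' \<psi>"
      using edge_contractions_pendant_extension[OF assms H] by blast
    have "mis H \<le> mis H'"
      using mis_pendant_extension H'(2) edge_contractions_wf[OF assms H] pendant_contractions_wf[OF assms H'(1)]
      by blast
    also have "\<dots> \<le> Max (mis ` pendant_contractions G)" using finP H'(1) by (intro Max_ge) auto
    finally show ?thesis .
  qed
  then show "Max (mis ` edge_contractions G) \<le> Max (mis ` pendant_contractions G)"
    using finE edge_contractions.refl by (subst Max_le_iff) auto
  \<comment> \<open>The upper bound is known for individual graphs, so the maximum is replaced by a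
    graph that attains it.\<close>
  have "Max (mis ` pendant_contractions G) \<in> mis ` pendant_contractions G"
    using finP pendant_contractions.refl by (intro Max_in) auto
  then obtain H where H: "H \<in> pendant_contractions G" "Max (mis ` pendant_contractions G) = mis H" by auto
  obtain \<phi> where "contraction_model G H \<phi>"
    using pair_graph.pendant_contractions_model[OF assms H(1)] by blast
  then show "real (Max (mis ` pendant_contractions G)) \<le> (3 / 2) ^ C4_matching_number G * real (mis G)"
    using pair_graph.mis_contraction_model_bound[OF assms] pendant_contractions_wf[OF assms H(1)] H(2) by simp
qed

end
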